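(* Assume in addition that $l$ is $\mu$-strongly convex on $\mathcal{X}$ for some $\mu>0$. Consider SPDHG (as in the context) run with step-sizes $\beta^{k+1} = \frac{2}{\mu(k+2)+2L}$ and non-uniform weights $\alpha^{k+1}=\frac{2(k+1)}{(t+1)(t+2)}$, $k=0,\dots,t$. Let $(y^*,x^* )$ be any saddle point of $\min_{x\in\mathcal{X}}\max_{y\in\mathcal{Y}}P(y,x)$. Then for every $\Omega>0$ and $t\ge0$, $$\mathrm{Prob}\left(P(y^*,\bar{x}^t) - P(\bar{y}^t,x^* ) > \frac{D_y^2}{s(t+2)} + \frac{L D_x^2}{t+2} + \frac{4\lambda_{\max}(F^\top F)D_y^2}{\mu(t+2)} + \frac{2\sqrt{2\Omega} D_x \sigma}{\sqrt{t+2}} + \frac{4(1+\Omega) \sigma^2}{\mu(t+2)}\right) \leq 2\exp(-\Omega).$$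
   Context: Setting: $\mathcal{X}\subset\mathbb{R}^d$ is a nonempty convex compact set with diameter $D_x$ (so $\|x-x'\|\le D_x$ for all $x,x'\in\mathcal{X}$), $\mathcal{Y}\subset\mathbb{R}^l$ is a nonempty convex compact set with diameter $D_y$, $F\in\mathbb{R}^{l\times d}$, and $\lambda_{\max}(F^\top F)$ denotes the largest eigenvalue of $F^\top F$. The loss is $l(x)=\mathbb{E}_\xi[l(x,\xi)]$, a convex, continuously differentiable function on $\mathcal{X}$ with $L$-Lipschitz gradient: $\|\nabla l(x_1)-\nabla l(x_2)\|\le L\|x_1-x_2\|$ for all $x_1,x_2\in\mathcal{X}$. $\mu$-strong convexity means $l(y)-l(x)-(y-x)^\top\nabla l(x)\ge\frac{\mu}{2}\|y-x\|^2$ for all $x,y\in\mathcal{X}$. The stochastic gradient $\nabla l(x,\xi)$ satisfies, for every $x\in\mathcal{X}$: $\mathbb{E}[\nabla l(x,\xi)]=\nabla l(x)$, $\mathbb{E}\|\nabla l(x,\xi)-\nabla l(x)\|^2\le\sigma^2$, and $\mathbb{E}\exp\left(\|\nabla l(x,\xi)-\nabla l(x)\|^2/\sigma^2\right)\le \exp(1)$, for a constant $\sigma>0$. The saddle function is $P(y,x)=l(x)+\langle y,Fx\rangle$ for $x\in\mathcal{X},y\in\mathcal{Y}$; a saddle point $(y^*,x^* )$ satisfies $P(y,x^* )\le P(y^*,x^* )\le P(y^*,x)$ for all $(y,x)\in\mathcal{Y}\times\mathcal{X}$ (assumed to exist). SPDHG: fix $s>0$, $x^0\in\mathcal{X}$,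 $y^0\in\mathcal{Y}$, and a sequence of step-sizes $\beta^{k+1}>0$. For $k=0,1,2,\dots$, draw a sample $\xi^{k+1}$ independently of the past (i.i.d. samples), and set $$y^{k+1}=\arg\max_{y\in\mathcal{Y}}\Big\{P(y,x^k)-\tfrac{1}{2s}\|y-y^k\|^2\Big\},\qquad x^{k+1}=\Pi_{\mathcal{X}}\Big[x^k-\beta^{k+1}\big(\nabla l(x^k,\xi^{k+1})+F^\top y^{k+1}\big)\Big],$$ where $\Pi_{\mathcal{X}}$ is Euclidean projection onto $\mathcal{X}$. Given weights $\alpha^{k+1}\ge0$ with $\sum_{k=0}^t\alpha^{k+1}=1$, the output after $t$ steps is $\bar x^t=\sum_{k=0}^t\alpha^{k+1}x^{k+1}$, $\bar y^t=\sum_{k=0}^t\alpha^{k+1}y^{k+1}$. *)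

theory Defs
  imports "HOL-Analysis.Analysis" "HOL-Probability.Probability"
begin

definition saddle_fn ::
  "(real^'d \<Rightarrow> real) \<Rightarrow> real^'d^'l \<Rightarrow> real^'l \<Rightarrow> real^'d \<Rightarrow> real" where
  "saddle_fn l F y x = l x + y \<bullet> (F *v x)"

definition lambda_max :: "real^'n^'n \<Rightarrow> real" where
  "lambda_max A = Max {c. \<exists>v. v \<noteq> 0 \<and> A *v v = c *\<^sub>R v}"

text \<open>SPDHG iterates (y^k, x^k) along a sample path: step k uses the sample
  xi (Suc k) (= xi^{k+1}) and the step size beta (Suc k) (= beta^{k+1}).\<close>
fun spdhg ::
  "(real^'d \<Rightarrow> real) \<Rightarrow> real^'d^'l \<Rightarrow> (real^'d) set \<Rightarrow> (real^'l) set \<Rightarrow> real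
   \<Rightarrow> (real^'d \<Rightarrow> 'b \<Rightarrow> real^'d) \<Rightarrow> (nat \<Rightarrow> real) \<Rightarrow> real^'d \<Rightarrow> real^'l
   \<Rightarrow> (nat \<Rightarrow> 'b) \<Rightarrow> nat \<Rightarrow> (real^'l) \<times> (real^'d)" where
  "spdhg l F X Y s G beta x0 y0 xi 0 = (y0, x0)"
| "spdhg l F X Y s G beta x0 y0 xi (Suc k) =
     (let (yk, xk) = spdhg l F X Y s G beta x0 y0 xi k;
          y' = (THE y. y \<in> Y \<and> (\<forall>y'\<in>Y.
                  saddle_fn l F y' xk - (1 / (2 * s)) * (norm (y' - yk))\<^sup>2
                  \<le> saddle_fn l F y xk - (1 / (2 * s)) * (norm (y - yk))\<^sup>2));
          x' = closest_point X (xk - beta (Suc k) *\<^sub>R (G xk (xi (Suc k)) + transpose F *v y'))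
      in (y', x'))"

end

theory Submission
  imports Defs
begin

text \<open>
  Comparing one step with the saddle point, the projections give three-point inequalities, and
  smoothness and strong convexity of \<open>l\<close> bound the gap at step \<open>k\<close> by telescoping terms, a term
  quadratic in the noise \<open>\<delta>\<^sub>k = \<nabla>l(x\<^sub>k) - G(x\<^sub>k, \<xi>\<^sub>k\<^sub>+\<^sub>1)\<close> and the term \<open>\<delta>\<^sub>k \<bullet> (x\<^sub>k - x\<^sup>*)\<close>. With weights
  \<open>k + 1\<close> the strong convexity term turns the distances to \<open>x\<^sup>*\<close> into the telescoping sequence
  \<open>k (k + 1) \<parallel>x\<^sub>k - x\<^sup>*\<parallel>\<^sup>2\<close>.

  The squared noise is controlled by Jensen's and Markov's inequalities applied to the exponential
  moment. The linear noise term is a martingale: \<open>exp u \<le> u + exp (u\<^sup>2)\<close> yields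
  \<open>E exp (a Z) \<le> exp (a\<^sup>2 c\<^sup>2)\<close> for centred \<open>Z\<close> with \<open>E exp (Z\<^sup>2 / c\<^sup>2) \<le> exp 1\<close>, and conditioning on the
  past multiplies these bounds, after which Chernoff's bound applies. Each of the two events
  contributes \<open>exp (- \<Omega>)\<close>.

  A negative Lipschitz constant \<open>L\<close> is only possible when \<open>X\<close> is a singleton, so that the step
  size may be meaningless but the primal iterate is constant; otherwise \<open>\<mu> \<le> L\<close>.
\<close>

section \<open>Quadratic forms, projections and smoothness\<close>

text \<open>The Rayleigh quotient of \<open>transpose F ** F\<close> attains its maximum on the
  compact unit sphere, and a maximiser is an eigenvector. The best constant is therefore one of the
  eigenvalues over which \<open>lambda_max\<close> ranges.\<close>

lemma quadratic_form_le_lambda_max: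
  fixes F :: "real^'d^'l"
  shows "0 \<le> lambda_max (transpose F ** F)"
    and "(norm (F *v v))\<^sup>2 \<le> lambda_max (transpose F ** F) * (norm v)\<^sup>2"
proof -
  define A where "A = transpose F ** F"
  define E where "E = {c. \<exists>v. v \<noteq> 0 \<and> A *v v = c *\<^sub>R v}"
  have A_inner: "u \<bullet> (A *v w) = (F *v u) \<bullet> (F *v w)" for u w
    by (simp add: A_def dot_lmul_matrix flip: matrix_vector_mul_assoc)
       (metis dot_lmul_matrix inner_commute transpose_matrix_vector)
  have A_sym: "u \<bullet> (A *v w) = (A *v u) \<bullet> w" for u w
    by (metis A_inner inner_commute)
  \<comment> \<open>\<open>Max\<close> is informative only on a finite set. Eigenvectors of a
    symmetric matrix for distinct eigenvalues are orthogonal, hence independent, so the dimension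
    bounds their number.\<close>
  have "finite E"
  proof -
    obtain e where e: "\<And>c. c \<in> E \<Longrightarrow> e c \<noteq> 0 \<and> A *v e c = c *\<^sub>R e c"
      using bchoice[of E "\<lambda>c v. v \<noteq> 0 \<and> A *v v = c *\<^sub>R v"] unfolding E_def by blast
    have orth: "orthogonal (e c) (e c')" if "c \<in> E" "c' \<in> E" "c \<noteq> c'" for c c'
      using A_sym[of "e c" "e c'"] e[OF that(1)] e[OF that(2)] that(3)
      by (simp add: orthogonal_def)
    have inj: "inj_on e E"
      by (intro inj_onI) (metis e orth orthogonal_self)
    have "pairwise orthogonal (e ` E)"
      using orth by (auto simp: pairwise_def)
    then have "independent (e ` E)"
      using e by (intro pairwise_orthogonal_independent) auto
    then show ?thesis
      using inj finite_imageD independent_imp_finite by blast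
  qed
  obtain u :: "real^'d" where u: "norm u = 1"
    and u_max: "\<And>w. norm w = 1 \<Longrightarrow> norm (F *v w) \<le> norm (F *v u)"
  proof -
    have "continuous_on (sphere 0 1) (\<lambda>w::real^'d. norm (F *v w))"
      by (intro continuous_intros linear_continuous_on matrix_vector_mul_bounded_linear)
    then have "\<exists>u\<in>sphere (0::real^'d) 1. \<forall>w\<in>sphere 0 1. norm (F *v w) \<le> norm (F *v u)"
      by (intro continuous_attains_sup) auto
    then show ?thesis using that by auto
  qed
  define c where "c = (norm (F *v u))\<^sup>2"
  have bound: "(norm (F *v w))\<^sup>2 \<le> c * (norm w)\<^sup>2" for w
  proof (cases "w = 0")
    case False
    have "norm (F *v (inverse (norm w) *\<^sub>R w)) \<le> norm (F *v u)"
      using False by (intro u_max) simp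
    then have "norm (F *v w) \<le> norm (F *v u) * norm w"
      using False by (simp add: matrix_vector_mult_scaleR field_simps)
    then show ?thesis
      unfolding c_def by (metis norm_ge_zero power_mono power_mult_distrib)
  qed simp
  \<comment> \<open>The residual of the eigenvector equation. The form c |v|^2 - |F v|^2 is
    nonnegative and vanishes at \<open>u\<close>, so moving from \<open>u\<close> along
    \<open>- w\<close> cannot lower it to first order; this forces \<open>w = 0\<close>.\<close>
  define w where "w = c *\<^sub>R u - A *v u"
  have "w = 0"
  proof (rule ccontr)
    assume "w \<noteq> 0"
    define b where "b = c * (norm w)\<^sup>2 - (norm (F *v w))\<^sup>2"
    have b0: "b \<ge> 0" using bound[of w] by (simp add: b_def)
    have key: "2 * r * (norm w)\<^sup>2 \<le> r\<^sup>2 * b" for r :: real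
    proof -
      have "0 \<le> c * (norm (u - r *\<^sub>R w))\<^sup>2 - (norm (F *v (u - r *\<^sub>R w)))\<^sup>2"
        using bound[of "u - r *\<^sub>R w"] by simp
      also have "\<dots> = c * (norm u)\<^sup>2 - (norm (F *v u))\<^sup>2
          - 2 * r * (c * (u \<bullet> w) - (F *v u) \<bullet> (F *v w)) + r\<^sup>2 * b"
        unfolding b_def power2_norm_eq_inner
        by (simp add: matrix_vector_mult_diff_distrib matrix_vector_mult_scaleR
            inner_diff_left inner_diff_right algebra_simps power2_eq_square inner_commute)
      also have "c * (u \<bullet> w) - (F *v u) \<bullet> (F *v w) = (norm w)\<^sup>2"
        unfolding A_inner[symmetric] A_sym power2_norm_eq_inner
        by (simp add: w_def inner_diff_left)
      also have "c * (norm u)\<^sup>2 - (norm (F *v u))\<^sup>2 = 0"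
        by (simp add: u c_def)
      finally show ?thesis by simp
    qed
    have w2: "(norm w)\<^sup>2 > 0" using \<open>w \<noteq> 0\<close> by simp
    \<comment> \<open>Small enough that \<open>r * b\<close> is at most |w|^2, since
      \<open>b / (b + 1) \<le> 1\<close>; the \<open>+ 1\<close> covers
      \<open>b = 0\<close>.\<close>
    define r where "r = (norm w)\<^sup>2 / (b + 1)"
    have r0: "r > 0" using w2 b0 by (simp add: r_def)
    have "2 * (norm w)\<^sup>2 \<le> r * b"
      using key[of r] r0 by (simp add: power2_eq_square)
    also have "r * b \<le> (norm w)\<^sup>2"
      using b0 w2 by (simp add: r_def field_simps)
    finally show False using w2 by simp
  qed
  then have "c \<in> E"
    using u by (auto simp: E_def w_def intro!: exI[of _ u])
  then have c_le: "c \<le> lambda_max A"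
    using \<open>finite E\<close> unfolding lambda_max_def E_def by simp
  show "0 \<le> lambda_max (transpose F ** F)"
    using c_le unfolding A_def c_def by (meson order_trans zero_le_power2)
  show "(norm (F *v v))\<^sup>2 \<le> lambda_max (transpose F ** F) * (norm v)\<^sup>2"
    using bound[of v] c_le mult_right_mono[of c "lambda_max A" "(norm v)\<^sup>2"]
    unfolding A_def by simp
qed

section \<open>Projections and the two half-steps of the iteration\<close>

text \<open>The variational inequality of the projection, rewritten by polarization into squared
  distances that can later telescope.\<close>

lemma closest_point_three_point:
  fixes p g :: "'a::euclidean_space" and b :: real
  assumes "convex S" "closed S" "u \<in> S"
  defines "q \<equiv> closest_point S (p - b *\<^sub>R g)"
  shows "2 * b * (g \<bullet> (q - u)) \<le> (norm (u - p))\<^sup>2 - (norm (u - q))\<^sup>2 - (norm (q - p))\<^sup>2"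
proof -
  have "(p - b *\<^sub>R g - q) \<bullet> (u - q) \<le> 0"
    unfolding q_def using assms(1-3) by (rule closest_point_dot)
  then show ?thesis
    unfolding power2_norm_eq_inner
    by (simp add: inner_diff_left inner_diff_right algebra_simps inner_commute)
qed

text \<open>Completing the square turns the objective into a constant minus a multiple of a squared
  distance, so maximisers are nearest points. Their uniqueness makes the \<open>THE\<close> well
  defined.\<close>

lemma argmax_proximal_eq_closest_point:
  fixes c q :: "'a::euclidean_space"
  assumes "convex Y" "closed Y" "Y \<noteq> {}" "s > 0"
  shows "(THE y. y \<in> Y \<and> (\<forall>y'\<in>Y. a + y' \<bullet> c - (1 / (2 * s)) * (norm (y' - q))\<^sup>2
            \<le> a + y \<bullet> c - (1 / (2 * s)) * (norm (y - q))\<^sup>2))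
         = closest_point Y (q + s *\<^sub>R c)"
proof -
  let ?p = "q + s *\<^sub>R c"
  have val: "a + y \<bullet> c - (1 / (2 * s)) * (norm (y - q))\<^sup>2
      = a + q \<bullet> c + s / 2 * (c \<bullet> c) - (1 / (2 * s)) * (dist ?p y)\<^sup>2" for y
    using assms(4) unfolding dist_norm power2_norm_eq_inner
    by (simp add: inner_diff_left inner_diff_right inner_add_left inner_add_right
        field_simps inner_commute power2_eq_square)
  have le: "a + y' \<bullet> c - (1 / (2 * s)) * (norm (y' - q))\<^sup>2
      \<le> a + y \<bullet> c - (1 / (2 * s)) * (norm (y - q))\<^sup>2 \<longleftrightarrow> dist ?p y \<le> dist ?p y'" for y y'
    unfolding val using assms(4) by (simp add: divide_le_cancel)
  show ?thesis
    unfolding le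
  proof (rule the_equality)
    show "closest_point Y ?p \<in> Y \<and> (\<forall>y'\<in>Y. dist ?p (closest_point Y ?p) \<le> dist ?p y')"
      using closest_point_exists[OF assms(2,3)] by blast
  next
    fix y assume "y \<in> Y \<and> (\<forall>y'\<in>Y. dist ?p y \<le> dist ?p y')"
    then show "y = closest_point Y ?p"
      using closest_point_unique[OF assms(1,2)] by blast
  qed
qed

lemma spdhg_Suc:
  assumes "convex Y" "closed Y" "Y \<noteq> {}" "s > 0"
  shows "fst (spdhg l F X Y s G beta x0 y0 z (Suc k))
      = closest_point Y (fst (spdhg l F X Y s G beta x0 y0 z k)
          + s *\<^sub>R (F *v snd (spdhg l F X Y s G beta x0 y0 z k)))"
    and "snd (spdhg l F X Y s G beta x0 y0 z (Suc k))
      = closest_point X (snd (spdhg l F X Y s G beta x0 y0 z k)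
          - beta (Suc k) *\<^sub>R (G (snd (spdhg l F X Y s G beta x0 y0 z k)) (z (Suc k))
              + transpose F *v fst (spdhg l F X Y s G beta x0 y0 z (Suc k))))"
  unfolding spdhg.simps Let_def split_beta saddle_fn_def fst_conv snd_conv
    argmax_proximal_eq_closest_point[OF assms] by (rule refl)+

section \<open>Smoothness and elementary inequalities\<close>

text \<open>Along the segment, the difference \<open>\<psi>\<close> between \<open>f\<close> and its
  quadratic model has nonpositive derivative by Cauchy-Schwarz and the Lipschitz bound; the mean
  value theorem concludes. Derivatives are taken within \<open>{0..1}\<close> because
  \<open>f\<close> is differentiable only within \<open>X\<close>.\<close>

lemma lipschitz_gradient_upper_bound:
  fixes f :: "'a::euclidean_space \<Rightarrow> real"
  assumes "convex X"
    and deriv: "\<And>x. x \<in> X \<Longrightarrow> (f has_derivative (\<lambda>h. g x \<bullet> h)) (at x within X)"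
    and Lip: "\<And>x y. x \<in> X \<Longrightarrow> y \<in> X \<Longrightarrow> norm (g x - g y) \<le> L * norm (x - y)"
    and x: "x \<in> X" and y: "y \<in> X"
  shows "f y \<le> f x + g x \<bullet> (y - x) + L / 2 * (norm (y - x))\<^sup>2"
proof -
  define h where "h = y - x"
  define p where "p r = x + r *\<^sub>R h" for r :: real
  have p_mem: "p r \<in> X" if "r \<in> {0..1}" for r
    using convexD_alt[OF assms(1) x y, of r] that
    by (simp add: p_def h_def algebra_simps)
  define \<psi> where "\<psi> r = f (p r) - r * (g x \<bullet> h) - L / 2 * r\<^sup>2 * (norm h)\<^sup>2" for r
  have "\<psi> 1 \<le> \<psi> 0"
  proof -
    have d: "(\<psi> has_real_derivative g (p r) \<bullet> h - g x \<bullet> h - L * r * (norm h)\<^sup>2)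
        (at r within {0..1})" if r: "r \<in> {0..1}" for r
    proof -
      have "(p has_derivative (\<lambda>d. d *\<^sub>R h)) (at r within {0..1})"
        unfolding p_def by (auto intro!: derivative_eq_intros)
      then have "((\<lambda>r. f (p r)) has_derivative (\<lambda>d. g (p r) \<bullet> (d *\<^sub>R h))) (at r within {0..1})"
        using p_mem r by (intro has_derivative_in_compose2[OF deriv]) auto
      then have "((\<lambda>r. f (p r)) has_real_derivative g (p r) \<bullet> h) (at r within {0..1})"
        by (simp add: has_field_derivative_def mult.commute[of _ "g (p r) \<bullet> h"])
      then show ?thesis
        unfolding \<psi>_def by (auto intro!: derivative_eq_intros simp: power2_eq_square)
    qed
    have le: "g (p r) \<bullet> h - g x \<bullet> h - L * r * (norm h)\<^sup>2 \<le> 0" if r: "r \<in> {0..1}" for r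
    proof -
      have "(g (p r) - g x) \<bullet> h \<le> norm (g (p r) - g x) * norm h"
        by (rule norm_cauchy_schwarz)
      also have "\<dots> \<le> (L * norm (p r - x)) * norm h"
        by (intro mult_right_mono Lip p_mem r x) auto
      also have "\<dots> = L * r * (norm h)\<^sup>2"
        using r by (simp add: p_def power2_eq_square)
      finally show ?thesis by (simp add: inner_diff_left)
    qed
    obtain r where "r \<in> {0<..<1}"
      and "\<psi> 1 - \<psi> 0 = (g (p r) \<bullet> h - g x \<bullet> h - L * r * (norm h)\<^sup>2) * (1 - 0)"
      using mvt_simple[OF zero_less_one, of \<psi>
          "\<lambda>r d. (g (p r) \<bullet> h - g x \<bullet> h - L * r * (norm h)\<^sup>2) * d"] d
      by (auto simp: has_field_derivative_def)
    then show ?thesis using le[of r] by simp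
  qed
  then show ?thesis by (simp add: \<psi>_def p_def h_def)
qed

text \<open>The quadratic in \<open>d\<close> has maximum (a + b)^2 / c. This is how the negative
  squared step length absorbs the coupling and noise terms.\<close>

lemma weighted_square_le:
  fixes a b c d :: real
  assumes "c > 0"
  shows "(a + b) * d - c / 4 * d\<^sup>2 \<le> 2 * (a\<^sup>2 + b\<^sup>2) / c"
proof -
  have "c * ((a + b) * d - c / 4 * d\<^sup>2) \<le> (a + b)\<^sup>2"
    using zero_le_power2[of "a + b - c * d / 2"]
    by (simp add: power2_eq_square algebra_simps)
  also have "\<dots> \<le> 2 * (a\<^sup>2 + b\<^sup>2)"
    using zero_le_power2[of "a - b"] by (simp add: power2_eq_square algebra_simps)
  finally show ?thesis using assms by (simp add: field_simps)
qed

text \<open>Summation by parts: the weights grow by one per step, so each \<open>A k\<close>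
  survives exactly once.\<close>

lemma weighted_telescope_le:
  fixes A :: "nat \<Rightarrow> real"
  assumes "\<And>k. A k \<le> D" and "\<And>k. 0 \<le> A k"
  shows "(\<Sum>k\<le>t. (real k + 1) * (A k - A (Suc k))) \<le> (real t + 1) * D"
proof -
  have "(\<Sum>k\<le>t. (real k + 1) * (A k - A (Suc k))) = (\<Sum>k\<le>t. A k) - (real t + 1) * A (Suc t)"
    by (induction t) (simp_all add: algebra_simps)
  also have "\<dots> \<le> (\<Sum>k\<le>t. A k)" using assms(2) by simp
  also have "\<dots> \<le> (real t + 1) * D"
    using sum_bounded_above[of "{..t}" A D] assms(1) by (simp add: add.commute)
  finally show ?thesis .
qed

section \<open>Deterministic gap estimate\<close>

locale strongly_convex_saddle =
  fixes X :: "(real^'d) set" and Y :: "(real^'l) set" and F :: "real^'d^'l"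
    and l :: "real^'d \<Rightarrow> real" and grad :: "real^'d \<Rightarrow> real^'d"
    and L \<mu> s :: real and xs :: "real^'d" and ys :: "real^'l"
  assumes X: "convex X" "compact X" "X \<noteq> {}"
    and Y: "convex Y" "compact Y" "Y \<noteq> {}"
    and deriv: "\<And>x. x \<in> X \<Longrightarrow> (l has_derivative (\<lambda>h. grad x \<bullet> h)) (at x within X)"
    and lconv: "convex_on X l"
    and Lip: "\<And>x1 x2. x1 \<in> X \<Longrightarrow> x2 \<in> X \<Longrightarrow> norm (grad x1 - grad x2) \<le> L * norm (x1 - x2)"
    and mu_pos: "\<mu> > 0"
    and strong: "\<And>x y. x \<in> X \<Longrightarrow> y \<in> X \<Longrightarrow>
                   l y - l x - (y - x) \<bullet> grad x \<ge> \<mu> / 2 * (norm (y - x))\<^sup>2"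
    and s_pos: "s > 0"
    and xs: "xs \<in> X" and ys: "ys \<in> Y"
begin

abbreviation "lam \<equiv> lambda_max (transpose F ** F)"

lemma norm_diff_le_diameter_X: "u \<in> X \<Longrightarrow> v \<in> X \<Longrightarrow> norm (u - v) \<le> diameter X"
  using diameter_bounded_bound[OF compact_imp_bounded[OF X(2)]] by (simp add: dist_norm)

lemma norm_diff_le_diameter_Y: "u \<in> Y \<Longrightarrow> v \<in> Y \<Longrightarrow> norm (u - v) \<le> diameter Y"
  using diameter_bounded_bound[OF compact_imp_bounded[OF Y(2)]] by (simp add: dist_norm)

text \<open>Adding strong convexity at both points gives strong monotonicity of \<open>grad\<close>,
  which the Lipschitz bound caps. It makes \<open>L\<close> and the step-size denominators positive
  unless \<open>X\<close> is a singleton.\<close>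

lemma Lipschitz_constant_ge_mu:
  assumes "u \<in> X" "v \<in> X" "u \<noteq> v"
  shows "\<mu> \<le> L"
proof -
  have "\<mu> * (norm (u - v))\<^sup>2 \<le> (grad u - grad v) \<bullet> (u - v)"
    using strong[OF assms(1,2)] strong[OF assms(2,1)]
    by (simp add: norm_minus_commute[of v] inner_diff_left inner_diff_right
        inner_commute algebra_simps)
  also have "\<dots> \<le> norm (grad u - grad v) * norm (u - v)"
    by (rule norm_cauchy_schwarz)
  also have "\<dots> \<le> L * norm (u - v) * norm (u - v)"
    by (intro mult_right_mono Lip assms) auto
  finally show ?thesis
    using assms(3) by (simp add: power2_eq_square)
qed

lemma primal_step:
  fixes p v :: "real^'d" and j :: nat
  assumes p: "p \<in> X"
  defines "b \<equiv> 2 / (\<mu> * (real j + 1) + 2 * L)"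
  defines "q \<equiv> closest_point X (p - b *\<^sub>R v)"
  shows "v \<bullet> (q - xs) \<le> (\<mu> * (real j + 1) + 2 * L) / 4 *
           ((norm (xs - p))\<^sup>2 - (norm (xs - q))\<^sup>2 - (norm (q - p))\<^sup>2)"
\<comment> \<open>On a singleton the denominator of \<open>b\<close> may be zero or negative, but
  then \<open>p\<close>, \<open>q\<close> and \<open>xs\<close> coincide and both sides
  vanish.\<close>
proof (cases "\<forall>u\<in>X. u = xs")
  case True
  moreover have "q \<in> X"
    unfolding q_def using X by (intro closest_point_in_set compact_imp_closed)
  ultimately have "q = xs" "p = xs" using p by blast+
  then show ?thesis by simp
next
  case False
  then have "\<mu> \<le> L" using Lipschitz_constant_ge_mu xs by blast
  then have den: "\<mu> * (real j + 1) + 2 * L > 0"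
    using mu_pos by (intro add_nonneg_pos) auto
  have "2 * b * (v \<bullet> (q - xs)) \<le> (norm (xs - p))\<^sup>2 - (norm (xs - q))\<^sup>2 - (norm (q - p))\<^sup>2"
    unfolding q_def using X xs by (intro closest_point_three_point compact_imp_closed)
  then show ?thesis
    using den unfolding b_def by (simp add: field_simps)
qed

lemma dual_step:
  fixes q w :: "real^'l"
  assumes "u \<in> Y"
  defines "y' \<equiv> closest_point Y (q + s *\<^sub>R w)"
  shows "(u - y') \<bullet> w \<le> ((norm (u - q))\<^sup>2 - (norm (u - y'))\<^sup>2) / (2 * s)"
proof -
  \<comment> \<open>The ascent step is a projected step with direction \<open>- w\<close>, which
    fits the three-point inequality.\<close>
  have y': "y' = closest_point Y (q - s *\<^sub>R (- w))" by (simp add: y'_def)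
  have "2 * s * ((- w) \<bullet> (y' - u)) \<le> (norm (u - q))\<^sup>2 - (norm (u - y'))\<^sup>2 - (norm (y' - q))\<^sup>2"
    unfolding y' using Y assms by (intro closest_point_three_point compact_imp_closed)
  also have "\<dots> \<le> (norm (u - q))\<^sup>2 - (norm (u - y'))\<^sup>2" by simp
  also have "(- w) \<bullet> (y' - u) = (u - y') \<bullet> w"
    by (simp add: inner_diff_left inner_diff_right inner_commute)
  finally show ?thesis using s_pos by (simp add: field_simps)
qed

lemma coupling_le:
  assumes "u \<in> Y" "v \<in> Y"
  shows "(u - v) \<bullet> (F *v d) \<le> diameter Y * sqrt lam * norm d"
proof -
  have "norm (F *v d) \<le> sqrt (lam * (norm d)\<^sup>2)"
    using quadratic_form_le_lambda_max(2)[of F d] by (intro real_le_rsqrt)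
  then have Fd: "norm (F *v d) \<le> sqrt lam * norm d"
    by (simp add: real_sqrt_mult)
  have "(u - v) \<bullet> (F *v d) \<le> norm (u - v) * norm (F *v d)"
    by (rule norm_cauchy_schwarz)
  also have "\<dots> \<le> diameter Y * (sqrt lam * norm d)"
    using norm_diff_le_diameter_Y[OF assms] Fd
    by (intro mult_mono) (auto intro: order_trans[OF norm_ge_zero])
  finally show ?thesis by simp
qed

end

text \<open>Here \<open>g k\<close> is an arbitrary vector in place of the sampled gradient, so the
  estimates hold for every sample path. Step \<open>Suc k\<close> has denominator
  \<open>\<mu> * (k + 2) + 2 * L\<close>.\<close>

locale spdhg_path = strongly_convex_saddle X Y F l grad L \<mu> s xs ys
  for X :: "(real^'d) set" and Y :: "(real^'l) set" and F :: "real^'d^'l"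
    and l grad L \<mu> s xs ys +
  fixes x :: "nat \<Rightarrow> real^'d" and y :: "nat \<Rightarrow> real^'l" and g :: "nat \<Rightarrow> real^'d"
  assumes x_0: "x 0 \<in> X" and y_0: "y 0 \<in> Y"
    and y_Suc: "\<And>k. y (Suc k) = closest_point Y (y k + s *\<^sub>R (F *v x k))"
    and x_Suc: "\<And>k. x (Suc k) = closest_point X (x k -
          (2 / (\<mu> * (real (Suc k) + 1) + 2 * L)) *\<^sub>R (g k + transpose F *v y (Suc k)))"
begin

abbreviation noise :: "nat \<Rightarrow> real^'d" where
  "noise k \<equiv> grad (x k) - g k"

lemma x_mem: "x k \<in> X"
  using X by (cases k) (auto simp: x_0 x_Suc intro!: closest_point_in_set compact_imp_closed)

lemma y_mem: "y k \<in> Y"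
  using Y by (cases k) (auto simp: y_0 y_Suc intro!: closest_point_in_set compact_imp_closed)

text \<open>The dual update sees \<open>x k\<close> and not \<open>x (Suc k)\<close>, which leaves a
  coupling error in the step \<open>d\<close>. The noise splits into a part along \<open>d\<close>,
  absorbed with the coupling, and a part along \<open>x k - xs\<close>, kept for the martingale
  argument.\<close>

lemma one_step_gap:
  "saddle_fn l F ys (x (Suc k)) - saddle_fn l F (y (Suc k)) xs
    \<le> ((norm (ys - y k))\<^sup>2 - (norm (ys - y (Suc k)))\<^sup>2) / (2 * s)
      + (\<mu> * real k + 2 * L) / 4 * (norm (xs - x k))\<^sup>2
      - (\<mu> * (real k + 2) + 2 * L) / 4 * (norm (xs - x (Suc k)))\<^sup>2
      + 2 * ((diameter Y)\<^sup>2 * lam + (norm (noise k))\<^sup>2) / (\<mu> * (real k + 2))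
      + noise k \<bullet> (x k - xs)"
proof -
  define d where "d = x (Suc k) - x k"
  define B where "B = (norm (xs - x k))\<^sup>2"
  define B' where "B' = (norm (xs - x (Suc k)))\<^sup>2"
  have smooth: "l (x (Suc k)) \<le> l (x k) + grad (x k) \<bullet> d + L / 2 * (norm d)\<^sup>2"
    unfolding d_def by (rule lipschitz_gradient_upper_bound[OF X(1) deriv Lip x_mem x_mem])
  have sc: "l xs \<ge> l (x k) + grad (x k) \<bullet> (xs - x k) + \<mu> / 2 * B"
    using strong[OF x_mem[of k] xs] by (simp add: B_def inner_commute)
  have dual: "(ys - y (Suc k)) \<bullet> (F *v x k)
      \<le> ((norm (ys - y k))\<^sup>2 - (norm (ys - y (Suc k)))\<^sup>2) / (2 * s)"
    unfolding y_Suc using ys by (rule dual_step)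
  have primal: "(g k + transpose F *v y (Suc k)) \<bullet> (x (Suc k) - xs)
      \<le> (\<mu> * (real k + 2) + 2 * L) / 4 * (B - B' - (norm d)\<^sup>2)"
    using primal_step[OF x_mem[of k], where j = "Suc k" and v = "g k + transpose F *v y (Suc k)"]
    unfolding x_Suc[symmetric] by (simp add: B_def B'_def d_def add.commute)
  have tr: "(transpose F *v u) \<bullet> v = u \<bullet> (F *v v)" for u v
    by (simp add: dot_lmul_matrix)
  have coupling: "(ys - y (Suc k)) \<bullet> (F *v d) \<le> diameter Y * sqrt lam * norm d"
    using ys y_mem by (rule coupling_le)
  have noise_d: "noise k \<bullet> d \<le> norm (noise k) * norm d"
    by (rule norm_cauchy_schwarz)
  \<comment> \<open>The primal step provides \<open>- (\<mu> * (k + 2) + 2 * L) / 4\<close> times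
    |d|^2. Its \<open>L\<close> share cancels the smoothness term; the remaining
    \<open>\<mu>\<close> share pays for coupling and noise.\<close>
  have sq: "(diameter Y * sqrt lam + norm (noise k)) * norm d
        - \<mu> * (real k + 2) / 4 * (norm d)\<^sup>2
      \<le> 2 * ((diameter Y * sqrt lam)\<^sup>2 + (norm (noise k))\<^sup>2) / (\<mu> * (real k + 2))"
    using mu_pos by (intro weighted_square_le) simp
  have lam: "(diameter Y * sqrt lam)\<^sup>2 = (diameter Y)\<^sup>2 * lam"
    using quadratic_form_le_lambda_max(1)[of F] by (simp add: power_mult_distrib)
  have "saddle_fn l F ys (x (Suc k)) - saddle_fn l F (y (Suc k)) xs
      = l (x (Suc k)) - l xs + (ys - y (Suc k)) \<bullet> (F *v x k)
        + (ys - y (Suc k)) \<bullet> (F *v d) + (transpose F *v y (Suc k)) \<bullet> (x (Suc k) - xs)"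
    unfolding saddle_fn_def tr d_def
    by (simp add: matrix_vector_mult_diff_distrib inner_diff_left inner_diff_right)
  also have "\<dots> \<le> grad (x k) \<bullet> (d - (xs - x k)) + L / 2 * (norm d)\<^sup>2 - \<mu> / 2 * B
      + ((norm (ys - y k))\<^sup>2 - (norm (ys - y (Suc k)))\<^sup>2) / (2 * s)
      + diameter Y * sqrt lam * norm d + (transpose F *v y (Suc k)) \<bullet> (x (Suc k) - xs)"
    using smooth sc dual coupling by (simp add: inner_diff_right)
  also have "grad (x k) \<bullet> (d - (xs - x k))
      = g k \<bullet> (x (Suc k) - xs) + noise k \<bullet> d + noise k \<bullet> (x k - xs)"
    by (simp add: d_def inner_diff_left inner_diff_right)
  finally have "saddle_fn l F ys (x (Suc k)) - saddle_fn l F (y (Suc k)) xs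
    \<le> ((norm (ys - y k))\<^sup>2 - (norm (ys - y (Suc k)))\<^sup>2) / (2 * s)
      + (\<mu> * (real k + 2) + 2 * L) / 4 * (B - B' - (norm d)\<^sup>2)
      + L / 2 * (norm d)\<^sup>2 - \<mu> / 2 * B
      + (diameter Y * sqrt lam + norm (noise k)) * norm d + noise k \<bullet> (x k - xs)"
    using primal noise_d unfolding inner_add_left distrib_right[of "diameter Y * sqrt lam"]
    by linarith
  \<comment> \<open>Strong convexity lowers the coefficient of \<open>B\<close> from
    \<open>k + 2\<close> to \<open>k\<close>, which is what later makes the \<open>\<mu>\<close>
    terms telescope.\<close>
  also have "\<dots> = ((norm (ys - y k))\<^sup>2 - (norm (ys - y (Suc k)))\<^sup>2) / (2 * s)
      + (\<mu> * real k + 2 * L) / 4 * B - (\<mu> * (real k + 2) + 2 * L) / 4 * B'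
      + ((diameter Y * sqrt lam + norm (noise k)) * norm d
         - \<mu> * (real k + 2) / 4 * (norm d)\<^sup>2) + noise k \<bullet> (x k - xs)"
    by (simp add: field_simps)
  finally show ?thesis
    using sq unfolding lam B_def B'_def by linarith
qed

lemma weighted_gap_sum:
  "(\<Sum>k\<le>t. (real k + 1) * (saddle_fn l F ys (x (Suc k)) - saddle_fn l F (y (Suc k)) xs))
    \<le> (real t + 1) * (diameter Y)\<^sup>2 / (2 * s) + L * ((real t + 1) * (diameter X)\<^sup>2) / 2
      + 2 / \<mu> * ((real t + 1) * ((diameter Y)\<^sup>2 * lam))
      + 2 / \<mu> * (\<Sum>k\<le>t. (norm (noise k))\<^sup>2)
      + (\<Sum>k\<le>t. (real k + 1) * (noise k \<bullet> (x k - xs)))"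
proof -
  define A where "A k = (norm (ys - y k))\<^sup>2" for k
  define B where "B k = (norm (xs - x k))\<^sup>2" for k
  define N where "N k = noise k \<bullet> (x k - xs)" for k
  define C where "C = (diameter Y)\<^sup>2 * lam"
  have C0: "C \<ge> 0" unfolding C_def using quadratic_form_le_lambda_max(1)[of F] by simp
  have A_le: "A k \<le> (diameter Y)\<^sup>2" for k
    unfolding A_def by (intro power_mono norm_diff_le_diameter_Y ys y_mem) simp
  have B_le: "B k \<le> (diameter X)\<^sup>2" for k
    unfolding B_def by (intro power_mono norm_diff_le_diameter_X xs x_mem) simp
  have A_sum: "(\<Sum>k\<le>t. (real k + 1) * (A k - A (Suc k))) \<le> (real t + 1) * (diameter Y)\<^sup>2"
    by (rule weighted_telescope_le[OF A_le]) (simp add: A_def)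
  \<comment> \<open>Multiplying the telescoping bound by \<open>L\<close> needs
    \<open>L \<ge> 0\<close>; in the singleton case all distances and the diameter are zero
    instead.\<close>
  have B_sum: "L * (\<Sum>k\<le>t. (real k + 1) * (B k - B (Suc k))) \<le> L * ((real t + 1) * (diameter X)\<^sup>2)"
  proof (cases "\<forall>u\<in>X. u = xs")
    case True
    then have "X = {xs}" using xs by blast
    moreover have "B k = 0" for k using True x_mem[of k] by (simp add: B_def)
    ultimately show ?thesis by simp
  next
    case False
    then have "0 \<le> L" using Lipschitz_constant_ge_mu xs mu_pos by fastforce
    then show ?thesis
      by (intro mult_left_mono weighted_telescope_le[OF B_le]) (simp_all add: B_def)
  qed
  \<comment> \<open>The summand is a difference of consecutive values of k (k + 1) B_k. This
    vanishes at \<open>k = 0\<close>, so no initial distance remains and the total is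
    nonpositive.\<close>
  have tele: "(\<Sum>k\<le>t. (real k + 1) * (real k * B k - (real k + 2) * B (Suc k)))
      = - ((real t + 1) * (real t + 2) * B (Suc t))"
    by (induction t) (simp_all add: algebra_simps)
  have step: "(real k + 1) * (saddle_fn l F ys (x (Suc k)) - saddle_fn l F (y (Suc k)) xs)
      \<le> (real k + 1) * (A k - A (Suc k)) / (2 * s)
        + L * ((real k + 1) * (B k - B (Suc k))) / 2
        + \<mu> * ((real k + 1) * (real k * B k - (real k + 2) * B (Suc k))) / 4
        + 2 / \<mu> * (C + (norm (noise k))\<^sup>2) + (real k + 1) * N k" for k
  proof -
    have frac: "(real k + 1) * (2 * D / (\<mu> * (real k + 2)))
        = (real k + 1) / (real k + 2) * (2 / \<mu> * D)" for D
      by (simp add: mult_ac)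
    have "(real k + 1) * (saddle_fn l F ys (x (Suc k)) - saddle_fn l F (y (Suc k)) xs)
      \<le> (real k + 1) * ((A k - A (Suc k)) / (2 * s) + (\<mu> * real k + 2 * L) / 4 * B k
          - (\<mu> * (real k + 2) + 2 * L) / 4 * B (Suc k)
          + 2 * (C + (norm (noise k))\<^sup>2) / (\<mu> * (real k + 2)) + N k)"
      unfolding A_def B_def C_def N_def by (intro mult_left_mono one_step_gap) simp
    also have "\<dots> = (real k + 1) * (A k - A (Suc k)) / (2 * s)
        + L * ((real k + 1) * (B k - B (Suc k))) / 2
        + \<mu> * ((real k + 1) * (real k * B k - (real k + 2) * B (Suc k))) / 4
        + (real k + 1) / (real k + 2) * (2 / \<mu> * (C + (norm (noise k))\<^sup>2)) + (real k + 1) * N k"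
      unfolding distrib_left[of "real k + 1"] right_diff_distrib[of "real k + 1"] frac
      by (simp add: algebra_simps add_divide_distrib diff_divide_distrib)
    \<comment> \<open>The step-size denominator cancels the weight up to a factor below 1, leaving
      the squared noise unweighted.\<close>
    also have "(real k + 1) / (real k + 2) * (2 / \<mu> * (C + (norm (noise k))\<^sup>2))
        \<le> 1 * (2 / \<mu> * (C + (norm (noise k))\<^sup>2))"
      using C0 mu_pos by (intro mult_right_mono) simp_all
    finally show ?thesis by simp
  qed
  have "(\<Sum>k\<le>t. (real k + 1) * (saddle_fn l F ys (x (Suc k)) - saddle_fn l F (y (Suc k)) xs))
      \<le> (\<Sum>k\<le>t. (real k + 1) * (A k - A (Suc k)) / (2 * s)
        + L * ((real k + 1) * (B k - B (Suc k))) / 2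
        + \<mu> * ((real k + 1) * (real k * B k - (real k + 2) * B (Suc k))) / 4
        + 2 / \<mu> * (C + (norm (noise k))\<^sup>2) + (real k + 1) * N k)"
    by (intro sum_mono step)
  also have "\<dots> = (\<Sum>k\<le>t. (real k + 1) * (A k - A (Suc k))) / (2 * s)
      + L * (\<Sum>k\<le>t. (real k + 1) * (B k - B (Suc k))) / 2
      + \<mu> * (\<Sum>k\<le>t. (real k + 1) * (real k * B k - (real k + 2) * B (Suc k))) / 4
      + (2 / \<mu> * ((real t + 1) * C) + 2 / \<mu> * (\<Sum>k\<le>t. (norm (noise k))\<^sup>2))
      + (\<Sum>k\<le>t. (real k + 1) * N k)"
    by (simp add: sum.distrib sum_distrib_left sum_divide_distrib distrib_left)
  also have "\<dots> \<le> ((real t + 1) * (diameter Y)\<^sup>2) / (2 * s)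
      + L * ((real t + 1) * (diameter X)\<^sup>2) / 2 + 0
      + (2 / \<mu> * ((real t + 1) * C) + 2 / \<mu> * (\<Sum>k\<le>t. (norm (noise k))\<^sup>2))
      + (\<Sum>k\<le>t. (real k + 1) * N k)"
    unfolding tele using A_sum B_sum s_pos mu_pos
    by (intro add_mono divide_right_mono) (auto simp: B_def mult_nonneg_nonneg)
  finally show ?thesis unfolding N_def C_def by (simp only: add_0_right add.assoc)
qed

text \<open>Jensen's inequality moves the average out of \<open>l\<close>; the remaining parts of
  the gap are affine. Normalising the weighted sum leaves the factor \<open>2 / (t + 2)\<close> on
  the deterministic terms.\<close>

lemma averaged_gap:
  fixes t :: nat
  defines "\<alpha> \<equiv> \<lambda>j. 2 * real j / ((real t + 1) * (real t + 2))"
  shows "saddle_fn l F ys (\<Sum>k = 0..t. \<alpha> (Suc k) *\<^sub>R x (Suc k))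
      - saddle_fn l F (\<Sum>k = 0..t. \<alpha> (Suc k) *\<^sub>R y (Suc k)) xs
    \<le> (diameter Y)\<^sup>2 / (s * (real t + 2)) + L * (diameter X)\<^sup>2 / (real t + 2)
      + 4 * lam * (diameter Y)\<^sup>2 / (\<mu> * (real t + 2))
      + 2 / ((real t + 1) * (real t + 2)) * (\<Sum>k\<le>t. (real k + 1) * (noise k \<bullet> (x k - xs)))
      + 4 / (\<mu> * (real t + 1) * (real t + 2)) * (\<Sum>k\<le>t. (norm (noise k))\<^sup>2)"
proof -
  define c where "c = 2 / ((real t + 1) * (real t + 2))"
  have \<alpha>: "\<alpha> (Suc k) = c * (real k + 1)" for k by (simp add: \<alpha>_def c_def add.commute)
  have c0: "c \<ge> 0" by (simp add: c_def)
  have "(\<Sum>k\<le>t. real k + 1) = (real t + 1) * (real t + 2) / 2"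
    by (induction t) (simp_all add: field_simps)
  then have sum1: "(\<Sum>k\<le>t. \<alpha> (Suc k)) = 1"
    unfolding \<alpha> sum_distrib_left[symmetric] by (simp add: c_def)
  have l_le: "l (\<Sum>k\<le>t. \<alpha> (Suc k) *\<^sub>R x (Suc k)) \<le> (\<Sum>k\<le>t. \<alpha> (Suc k) * l (x (Suc k)))"
    using c0 x_mem by (intro convex_on_sum[OF _ _ lconv] sum1) (auto simp: \<alpha>)
  \<comment> \<open>The term \<open>l xs\<close> is given the total weight 1, so that the right-hand
    side becomes a weighted sum of one-step gaps.\<close>
  have "saddle_fn l F ys (\<Sum>k\<le>t. \<alpha> (Suc k) *\<^sub>R x (Suc k))
      - saddle_fn l F (\<Sum>k\<le>t. \<alpha> (Suc k) *\<^sub>R y (Suc k)) xs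
    \<le> (\<Sum>k\<le>t. \<alpha> (Suc k) * l (x (Suc k))) + ys \<bullet> (F *v (\<Sum>k\<le>t. \<alpha> (Suc k) *\<^sub>R x (Suc k)))
      - ((\<Sum>k\<le>t. \<alpha> (Suc k)) * l xs + (\<Sum>k\<le>t. \<alpha> (Suc k) *\<^sub>R y (Suc k)) \<bullet> (F *v xs))"
    using l_le unfolding saddle_fn_def sum1 by simp
  also have "\<dots> = (\<Sum>k\<le>t. \<alpha> (Suc k) *
      (saddle_fn l F ys (x (Suc k)) - saddle_fn l F (y (Suc k)) xs))"
    unfolding saddle_fn_def
    by (simp add: linear_sum[OF matrix_vector_mul_linear] matrix_vector_mult_scaleR
        inner_sum_left inner_sum_right sum_distrib_right sum.distrib sum_subtractf
        sum_distrib_left algebra_simps)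
  also have "\<dots> = c * (\<Sum>k\<le>t. (real k + 1) *
      (saddle_fn l F ys (x (Suc k)) - saddle_fn l F (y (Suc k)) xs))"
    by (simp add: \<alpha> sum_distrib_left mult_ac)
  also have "\<dots> \<le> c * ((real t + 1) * (diameter Y)\<^sup>2 / (2 * s)
      + L * ((real t + 1) * (diameter X)\<^sup>2) / 2 + 2 / \<mu> * ((real t + 1) * ((diameter Y)\<^sup>2 * lam))
      + 2 / \<mu> * (\<Sum>k\<le>t. (norm (noise k))\<^sup>2)
      + (\<Sum>k\<le>t. (real k + 1) * (noise k \<bullet> (x k - xs))))"
    using c0 by (intro mult_left_mono weighted_gap_sum)
  also have "\<dots> = c * (real t + 1) * ((diameter Y)\<^sup>2 / (2 * s) + L * (diameter X)\<^sup>2 / 2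
        + 2 * (lam * (diameter Y)\<^sup>2) / \<mu>)
      + c * (\<Sum>k\<le>t. (real k + 1) * (noise k \<bullet> (x k - xs)))
      + (c * (2 / \<mu>)) * (\<Sum>k\<le>t. (norm (noise k))\<^sup>2)"
    by (simp add: algebra_simps add_divide_distrib)
  also have "c * (real t + 1) = 2 / (real t + 2)"
    unfolding c_def by (simp add: divide_simps)
  also have "c * (2 / \<mu>) = 4 / (\<mu> * (real t + 1) * (real t + 2))" by (simp add: c_def mult_ac)
  also have "2 / (real t + 2) * ((diameter Y)\<^sup>2 / (2 * s) + L * (diameter X)\<^sup>2 / 2
        + 2 * (lam * (diameter Y)\<^sup>2) / \<mu>)
      = (diameter Y)\<^sup>2 / (s * (real t + 2)) + L * (diameter X)\<^sup>2 / (real t + 2)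
        + 4 * lam * (diameter Y)\<^sup>2 / (\<mu> * (real t + 2))"
  proof -
    have "2 / r * (a / (2 * s) + b / 2 + 2 * d / \<mu>) = a / (s * r) + b / r + 4 * d / (\<mu> * r)"
      for a b d r :: real
      by (simp add: distrib_left mult.commute)
    then show ?thesis by (simp only: mult.assoc)
  qed
  finally show ?thesis
    unfolding c_def atLeast0AtMost .
qed

end

section \<open>Exponential moments\<close>

text \<open>For \<open>x > 1\<close> already \<open>exp x \<le> exp (x * x)\<close>. Otherwise
  \<open>exp x \<le> 1 + x + x * x\<close>, which for negative \<open>x\<close> follows from
  \<open>exp x \<le> 1 / (1 - x)\<close>. In expectation the linear term drops out for centred
  variables.\<close>

lemma exp_le_add_exp_square: "exp x \<le> x + exp (x\<^sup>2)" for x :: real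
proof (cases "x \<le> 1")
  case False
  then have "x \<le> x\<^sup>2" by (simp add: power2_eq_square)
  then show ?thesis using False by (smt (verit) exp_le_cancel_iff)
next
  case True
  have "exp x \<le> 1 + x + x\<^sup>2"
  proof (cases "x \<ge> 0")
    case True
    then show ?thesis using exp_bound[of x] \<open>x \<le> 1\<close> by simp
  next
    case False
    have "exp x = 1 / exp (- x)" by (simp add: exp_minus inverse_eq_divide)
    also have "\<dots> \<le> 1 / (1 - x)"
      using False exp_ge_add_one_self[of "- x"] by (intro divide_left_mono) auto
    also have "\<dots> \<le> 1 + x + x\<^sup>2"
    proof -
      have "(1 + x + x\<^sup>2) * (1 - x) = 1 - x * x\<^sup>2" by (simp add: algebra_simps power2_eq_square)
      moreover have "x * x\<^sup>2 \<le> 0" using False by (simp add: mult_nonpos_nonneg)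
      ultimately show ?thesis using False by (simp add: field_simps)
    qed
    finally show ?thesis .
  qed
  then show ?thesis using exp_ge_add_one_self[of "x\<^sup>2"] by linarith
qed

context prob_space
begin

text \<open>Jensen's inequality for the concave power with exponent \<open>r\<close>, obtained from
  a pointwise bound so that everything stays within nonnegative integrals.\<close>

lemma exp_moment_power_le:
  assumes W[measurable]: "W \<in> borel_measurable M" and r: "0 \<le> r" "r \<le> 1"
    and W_exp: "(\<integral>\<^sup>+w. ennreal (exp (W w)) \<partial>M) \<le> ennreal (exp 1)"
  shows "(\<integral>\<^sup>+w. ennreal (exp (r * W w)) \<partial>M) \<le> ennreal (exp r)"
proof -
  \<comment> \<open>convexity of \<open>exp\<close> on the segment from 0 to \<open>W w - 1\<close>\<close>
  have pw: "exp (r * W w) \<le> exp r * (1 - r) + exp r * r * exp (- 1) * exp (W w)" for w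
  proof -
    have "convex_on UNIV (exp :: real \<Rightarrow> real)" by (rule exp_convex)
    then have "exp ((1 - r) * 0 + r * (W w - 1)) \<le> (1 - r) * exp 0 + r * exp (W w - 1)"
      using r convex_onD[of UNIV exp r 0 "W w - 1"] by simp
    then have "exp r * exp (r * (W w - 1)) \<le> exp r * (1 - r + r * (exp (- 1) * exp (W w)))"
      by (intro mult_left_mono) (simp_all add: exp_diff exp_minus field_simps)
    then show ?thesis by (simp add: algebra_simps flip: exp_add)
  qed
  have "(\<integral>\<^sup>+w. ennreal (exp (r * W w)) \<partial>M)
      \<le> (\<integral>\<^sup>+w. ennreal (exp r * (1 - r)) + ennreal (exp r * r * exp (- 1)) * ennreal (exp (W w)) \<partial>M)"
    using r pw by (intro nn_integral_mono) (simp flip: ennreal_plus ennreal_mult)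
  also have "\<dots> = ennreal (exp r * (1 - r))
      + ennreal (exp r * r * exp (- 1)) * (\<integral>\<^sup>+w. ennreal (exp (W w)) \<partial>M)"
    by (simp add: nn_integral_add nn_integral_cmult emeasure_space_1)
  also have "\<dots> \<le> ennreal (exp r * (1 - r)) + ennreal (exp r * r * exp (- 1)) * ennreal (exp 1)"
    using W_exp by (intro add_left_mono mult_left_mono) auto
  also have "\<dots> = ennreal (exp r)"
    using r by (simp add: algebra_simps flip: ennreal_plus ennreal_mult exp_add)
  finally show ?thesis .
qed

lemma subgaussian_mgf:
  assumes Z: "integrable M Z" "expectation Z = 0" and c: "c > 0"
    and Z_exp: "(\<integral>\<^sup>+w. ennreal (exp ((Z w)\<^sup>2 / c\<^sup>2)) \<partial>M) \<le> ennreal (exp 1)"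
  shows "(\<integral>\<^sup>+w. ennreal (exp (a * Z w)) \<partial>M) \<le> ennreal (exp (a\<^sup>2 * c\<^sup>2))"
proof (cases "a\<^sup>2 * c\<^sup>2 \<le> 1")
  case True
  have [measurable]: "Z \<in> borel_measurable M" using Z by simp
  have sq: "(\<integral>\<^sup>+w. ennreal (exp ((a * Z w)\<^sup>2)) \<partial>M) \<le> ennreal (exp (a\<^sup>2 * c\<^sup>2))"
    using exp_moment_power_le[OF _ _ True Z_exp] c by (simp add: power_mult_distrib)
  have int: "integrable M (\<lambda>w. exp ((a * Z w)\<^sup>2))"
    using sq by (intro integrableI_bounded) (auto intro: le_less_trans)
  have "(\<integral>\<^sup>+w. ennreal (exp (a * Z w)) \<partial>M) \<le> (\<integral>\<^sup>+w. ennreal (a * Z w + exp ((a * Z w)\<^sup>2)) \<partial>M)"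
    by (intro nn_integral_mono ennreal_leI exp_le_add_exp_square)
  also have "\<dots> = ennreal (expectation (\<lambda>w. a * Z w + exp ((a * Z w)\<^sup>2)))"
    using Z int by (intro nn_integral_eq_integral Bochner_Integration.integrable_add AE_I2)
      (auto intro: order_trans[OF _ exp_le_add_exp_square])
  also have "expectation (\<lambda>w. a * Z w + exp ((a * Z w)\<^sup>2)) = expectation (\<lambda>w. exp ((a * Z w)\<^sup>2))"
    using Z int by simp
  also have "ennreal \<dots> = (\<integral>\<^sup>+w. ennreal (exp ((a * Z w)\<^sup>2)) \<partial>M)"
    using int by (intro nn_integral_eq_integral[symmetric]) auto
  also note sq
  finally show ?thesis .
next
  case False
  have [measurable]: "Z \<in> borel_measurable M" using Z by simp
  \<comment> \<open>Young's inequality. The leftover moment of order 1/2 costs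
    \<open>exp (1 / 2)\<close>, which the other half of the exponent covers because its square
    product exceeds 1 here.\<close>
  have pw: "a * Z w \<le> a\<^sup>2 * c\<^sup>2 / 2 + 1 / 2 * ((Z w)\<^sup>2 / c\<^sup>2)" for w
  proof -
    have "0 \<le> (a * c - Z w / c)\<^sup>2" by simp
    also have "\<dots> = a\<^sup>2 * c\<^sup>2 + (Z w)\<^sup>2 / c\<^sup>2 - 2 * (a * Z w)"
      using c by (simp add: power2_diff power_mult_distrib power_divide)
    finally show ?thesis by simp
  qed
  have "(\<integral>\<^sup>+w. ennreal (exp (a * Z w)) \<partial>M)
      \<le> (\<integral>\<^sup>+w. ennreal (exp (a\<^sup>2 * c\<^sup>2 / 2)) * ennreal (exp (1 / 2 * ((Z w)\<^sup>2 / c\<^sup>2))) \<partial>M)"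
    using pw by (intro nn_integral_mono) (simp flip: ennreal_mult exp_add)
  also have "\<dots> = ennreal (exp (a\<^sup>2 * c\<^sup>2 / 2)) * (\<integral>\<^sup>+w. ennreal (exp (1 / 2 * ((Z w)\<^sup>2 / c\<^sup>2))) \<partial>M)"
    by (intro nn_integral_cmult) simp
  also have "\<dots> \<le> ennreal (exp (a\<^sup>2 * c\<^sup>2 / 2)) * ennreal (exp (1 / 2))"
    using Z_exp by (intro mult_left_mono exp_moment_power_le) auto
  also have "\<dots> \<le> ennreal (exp (a\<^sup>2 * c\<^sup>2))"
    using False by (simp flip: ennreal_mult exp_add)
  finally show ?thesis .
qed

lemma chernoff_bound:
  assumes [measurable]: "Z \<in> borel_measurable M"
    and mgf: "(\<integral>\<^sup>+w. ennreal (exp (Z w)) \<partial>M) \<le> ennreal (exp c)"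
  shows "prob {w \<in> space M. Z w \<ge> b} \<le> exp (c - b)"
proof -
  have "emeasure M {w \<in> space M. Z w \<ge> b}
      \<le> ennreal (exp (- 1 * b)) * (\<integral>\<^sup>+w. ennreal (exp (1 * Z w)) * indicator (space M) w \<partial>M)"
    by (intro Chernoff_ineq_nn_integral_ge) auto
  also have "(\<integral>\<^sup>+w. ennreal (exp (1 * Z w)) * indicator (space M) w \<partial>M)
      = (\<integral>\<^sup>+w. ennreal (exp (Z w)) \<partial>M)"
    by (intro nn_integral_cong) simp
  also have "ennreal (exp (- 1 * b)) * (\<integral>\<^sup>+w. ennreal (exp (Z w)) \<partial>M)
      \<le> ennreal (exp (- 1 * b)) * ennreal (exp c)"
    using mgf by (rule mult_left_mono) simp
  also have "\<dots> = ennreal (exp (c - b))"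
    by (simp flip: ennreal_mult exp_add)
  finally show ?thesis by (simp add: emeasure_eq_measure)
qed

text \<open>Tonelli on the joint law, a product by independence: conditioning on \<open>U\<close> in
  the form of freezing its value.\<close>

lemma nn_integral_indep_var:
  assumes indep: "indep_var A U B V"
    and H: "(\<lambda>(u, v). H u v) \<in> borel_measurable (A \<Otimes>\<^sub>M B)"
  shows "(\<integral>\<^sup>+w. H (U w) (V w) \<partial>M) = (\<integral>\<^sup>+w. (\<integral>\<^sup>+v. H (U w) v \<partial>distr M B V) \<partial>M)"
proof -
  have [measurable]: "U \<in> measurable M A" "V \<in> measurable M B"
    using indep by (auto dest: indep_var_rv1 indep_var_rv2)
  interpret V: prob_space "distr M B V" by (rule prob_space_distr) simp
  have HV: "(\<lambda>p. case p of (u, v) \<Rightarrow> H u v) \<in> borel_measurable (A \<Otimes>\<^sub>M distr M B V)"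
    using H by (simp cong: measurable_cong_sets)
  have "(\<integral>\<^sup>+w. H (U w) (V w) \<partial>M)
      = (\<integral>\<^sup>+p. (case p of (u, v) \<Rightarrow> H u v) \<partial>distr M (A \<Otimes>\<^sub>M B) (\<lambda>w. (U w, V w)))"
    using H by (subst nn_integral_distr) auto
  also have "distr M (A \<Otimes>\<^sub>M B) (\<lambda>w. (U w, V w)) = distr M A U \<Otimes>\<^sub>M distr M B V"
    using indep by (simp add: indep_var_distribution_eq)
  also have "(\<integral>\<^sup>+p. (case p of (u, v) \<Rightarrow> H u v) \<partial>(distr M A U \<Otimes>\<^sub>M distr M B V))
      = (\<integral>\<^sup>+u. (\<integral>\<^sup>+v. H u v \<partial>distr M B V) \<partial>distr M A U)"
    using HV by (subst V.nn_integral_fst[symmetric]) (simp_all cong: measurable_cong_sets)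
  also have "\<dots> = (\<integral>\<^sup>+w. (\<integral>\<^sup>+v. H (U w) v \<partial>distr M B V) \<partial>M)"
    using V.borel_measurable_nn_integral_fst[OF HV]
    by (subst nn_integral_distr) (simp_all cong: measurable_cong_sets)
  finally show ?thesis .
qed

end

section \<open>Random iterates\<close>

text \<open>Adaptedness of the iterates: step \<open>Suc k\<close> reads only the sample with index
  \<open>Suc k\<close>, so index 0 is never read.\<close>

lemma spdhg_cong:
  assumes "\<And>i. i \<in> {1..k} \<Longrightarrow> z i = z' i"
  shows "spdhg l F X Y s G beta x0 y0 z k = spdhg l F X Y s G beta x0 y0 z' k"
  using assms by (induction k) (simp_all add: Let_def split_beta)

lemma closest_point_borel_measurable:
  fixes S :: "'a::euclidean_space set"
  assumes "convex S" "closed S" "S \<noteq> {}"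
  shows "closest_point S \<in> borel_measurable borel"
  using continuous_on_closest_point[OF assms] by (rule borel_measurable_continuous_onI)

lemma matrix_vector_mult_borel_measurable [measurable]:
  fixes A :: "real^'n^'m"
  shows "(*v) A \<in> borel_measurable borel"
  by (intro borel_measurable_continuous_onI linear_continuous_on matrix_vector_mul_bounded_linear)

locale spdhg_sampling =
  strongly_convex_saddle X Y F l grad L \<mu> s xs ys + prob_space M
  for X :: "(real^'d) set" and Y :: "(real^'l) set" and F :: "real^'d^'l"
    and l grad L \<mu> s xs ys and M :: "'w measure" +
  fixes S Q :: "'b measure" and G :: "real^'d \<Rightarrow> 'b \<Rightarrow> real^'d" and xi :: "nat \<Rightarrow> 'w \<Rightarrow> 'b"
    and \<sigma> :: real and x0 :: "real^'d" and y0 :: "real^'l"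
  assumes grad_cont: "continuous_on X grad"
    and sigma_pos: "\<sigma> > 0"
    and G_meas: "(\<lambda>p. G (fst p) (snd p)) \<in> borel_measurable (borel \<Otimes>\<^sub>M S)"
    and G_int: "\<And>x. x \<in> X \<Longrightarrow> integrable Q (G x)"
    and G_mean: "\<And>x. x \<in> X \<Longrightarrow> (\<integral>z. G x z \<partial>Q) = grad x"
    and G_subg: "\<And>x. x \<in> X \<Longrightarrow>
                  (\<integral>\<^sup>+z. ennreal (exp ((norm (G x z - grad x))\<^sup>2 / \<sigma>\<^sup>2)) \<partial>Q) \<le> ennreal (exp 1)"
    and xi_indep: "indep_vars (\<lambda>_. S) xi {1..}"
    and xi_distr: "\<And>k. k \<ge> 1 \<Longrightarrow> distr M S (xi k) = Q"
    and x0: "x0 \<in> X" and y0: "y0 \<in> Y"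
begin

abbreviation iterate :: "(nat \<Rightarrow> 'b) \<Rightarrow> nat \<Rightarrow> (real^'l) \<times> (real^'d)" where
  "iterate z k \<equiv> spdhg l F X Y s G (\<lambda>j. 2 / (\<mu> * (real j + 1) + 2 * L)) x0 y0 z k"

definition xit :: "(nat \<Rightarrow> 'b) \<Rightarrow> nat \<Rightarrow> real^'d" where
  "xit z k = snd (iterate z k)"

definition yit :: "(nat \<Rightarrow> 'b) \<Rightarrow> nat \<Rightarrow> real^'l" where
  "yit z k = fst (iterate z k)"

text \<open>The pathwise estimates become available for every sequence \<open>z\<close>, including
  truncated pasts; in particular all such iterates lie in \<open>X\<close> and
  \<open>Y\<close>.\<close>

sublocale path: spdhg_path X Y F l grad L \<mu> s xs ys "xit z" "yit z"
    "\<lambda>k. G (xit z k) (z (Suc k))" for z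
proof unfold_locales
  show "xit z 0 \<in> X" "yit z 0 \<in> Y"
    by (simp_all add: xit_def yit_def x0 y0)
  show "yit z (Suc k) = closest_point Y (yit z k + s *\<^sub>R (F *v xit z k))" for k
    unfolding xit_def yit_def using Y s_pos by (intro spdhg_Suc(1) compact_imp_closed)
  show "xit z (Suc k) = closest_point X (xit z k - (2 / (\<mu> * (real (Suc k) + 1) + 2 * L)) *\<^sub>R
      (G (xit z k) (z (Suc k)) + transpose F *v yit z (Suc k)))" for k
    unfolding xit_def yit_def using Y s_pos by (intro spdhg_Suc(2) compact_imp_closed)
qed

text \<open>The fresh sample is a separate argument so that it can be integrated out with the past
  held fixed.\<close>

definition err :: "nat \<Rightarrow> (nat \<Rightarrow> 'b) \<Rightarrow> 'b \<Rightarrow> real^'d" where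
  "err k z v = grad (xit z k) - G (xit z k) v"

text \<open>Restriction places the samples in the product space over \<open>{1..k}\<close>, where
  independence of blocks is available.\<close>

definition past :: "nat \<Rightarrow> 'w \<Rightarrow> nat \<Rightarrow> 'b" where
  "past k w = restrict (\<lambda>i. xi i w) {1..k}"

lemma xit_past: "xit (\<lambda>i. xi i w) k = xit (past n w) k" if "k \<le> n"
  unfolding xit_def using that by (subst spdhg_cong[where z' = "past n w"]) (auto simp: past_def)

lemma xi_measurable [measurable]: "xi (Suc k) \<in> measurable M S"
  using xi_indep by (auto simp: indep_vars_def)

lemma past_measurable [measurable]: "past k \<in> measurable M (Pi\<^sub>M {1..k} (\<lambda>_. S))"
  unfolding past_def
proof (rule measurable_restrict)
  show "xi i \<in> measurable M S" if "i \<in> {1..k}" for i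
    using xi_indep that by (auto simp: indep_vars_def)
qed

section \<open>Conditioning on the past and measurability\<close>

text \<open>The sample blocks over \<open>{1..k}\<close> and \<open>{Suc k}\<close> are independent.
  The second block is a one-coordinate product space, from which the sample and its law
  \<open>Q\<close> are read off by projection.\<close>

lemma nn_integral_next_sample:
  assumes H: "(\<lambda>(z, v). H z v) \<in> borel_measurable (Pi\<^sub>M {1..k} (\<lambda>_. S) \<Otimes>\<^sub>M S)"
  shows "(\<integral>\<^sup>+w. H (past k w) (xi (Suc k) w) \<partial>M) = (\<integral>\<^sup>+w. (\<integral>\<^sup>+v. H (past k w) v \<partial>Q) \<partial>M)"
proof -
  let ?P = "Pi\<^sub>M {1..k} (\<lambda>_. S)" and ?N = "Pi\<^sub>M {Suc k} (\<lambda>_. S)"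
  let ?next = "\<lambda>w. restrict (\<lambda>i. xi i w) {Suc k}"
  have indep: "indep_var ?P (past k) ?N ?next"
    unfolding past_def[abs_def] by (rule indep_var_restrict[OF xi_indep]) auto
  have next_meas: "?next \<in> measurable M ?N"
    using indep by (rule indep_var_rv2)
  have comp: "(\<lambda>u. u (Suc k)) \<in> measurable ?N S"
    by (rule measurable_component_singleton) simp
  have "(\<lambda>p. (fst p, snd p (Suc k))) \<in> measurable (?P \<Otimes>\<^sub>M ?N) (?P \<Otimes>\<^sub>M S)"
    using comp by measurable
  from measurable_compose[OF this H]
  have H': "(\<lambda>(z, u). H z (u (Suc k))) \<in> borel_measurable (?P \<Otimes>\<^sub>M ?N)"
    by (simp add: split_beta')
  have "(\<integral>\<^sup>+w. H (past k w) (xi (Suc k) w) \<partial>M)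
      = (\<integral>\<^sup>+w. (\<integral>\<^sup>+u. H (past k w) (u (Suc k)) \<partial>distr M ?N ?next) \<partial>M)"
    using nn_integral_indep_var[OF indep H'] by simp
  also have "\<dots> = (\<integral>\<^sup>+w. (\<integral>\<^sup>+v. H (past k w) v \<partial>Q) \<partial>M)"
  proof (rule nn_integral_cong)
    fix w assume "w \<in> space M"
    then have z: "past k w \<in> space ?P" by (rule measurable_space[OF past_measurable])
    have Hz: "H (past k w) \<in> borel_measurable S"
      using measurable_compose[OF measurable_Pair1'[OF z] H] by simp
    have "(\<integral>\<^sup>+u. H (past k w) (u (Suc k)) \<partial>distr M ?N ?next)
        = (\<integral>\<^sup>+w'. H (past k w) (xi (Suc k) w') \<partial>M)"
      using measurable_compose[OF comp Hz] next_meas by (subst nn_integral_distr) auto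
    also have "\<dots> = (\<integral>\<^sup>+v. H (past k w) v \<partial>distr M S (xi (Suc k)))"
      using Hz by (subst nn_integral_distr) auto
    finally show "(\<integral>\<^sup>+u. H (past k w) (u (Suc k)) \<partial>distr M ?N ?next)
        = (\<integral>\<^sup>+v. H (past k w) v \<partial>Q)"
      using xi_distr[of "Suc k"] by simp
  qed
  finally show ?thesis .
qed

lemma G_measurable [measurable (raw)]:
  assumes "f \<in> borel_measurable N" "h \<in> measurable N S"
  shows "(\<lambda>w. G (f w) (h w)) \<in> borel_measurable N"
  using measurable_compose[OF measurable_Pair[OF assms] G_meas] by simp

text \<open>A general index set \<open>I\<close> lets all iterates of the induction live on one
  product space.\<close>

lemma iterate_measurable:
  assumes "{1..k} \<subseteq> I"
  shows "(\<lambda>z. xit z k) \<in> borel_measurable (Pi\<^sub>M I (\<lambda>_. S))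
       \<and> (\<lambda>z. yit z k) \<in> borel_measurable (Pi\<^sub>M I (\<lambda>_. S))"
  using assms
proof (induction k)
  case 0
  then show ?case by (simp add: xit_def yit_def)
next
  case (Suc k)
  have "{1..k} \<subseteq> I" "Suc k \<in> I" using Suc.prems by auto
  note [measurable] = Suc.IH[OF this(1), THEN conjunct1] Suc.IH[OF this(1), THEN conjunct2]
    measurable_component_singleton[OF this(2), of "\<lambda>_. S"]
    closest_point_borel_measurable[OF X(1) compact_imp_closed[OF X(2)] X(3)]
    closest_point_borel_measurable[OF Y(1) compact_imp_closed[OF Y(2)] Y(3)]
  have [measurable]: "(\<lambda>z. yit z (Suc k)) \<in> borel_measurable (Pi\<^sub>M I (\<lambda>_. S))"
    unfolding path.y_Suc by measurable
  have "(\<lambda>z. xit z (Suc k)) \<in> borel_measurable (Pi\<^sub>M I (\<lambda>_. S))"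
    unfolding path.x_Suc by measurable
  then show ?case by simp
qed

lemma xit_measurable [measurable]: "(\<lambda>z. xit z k) \<in> borel_measurable (Pi\<^sub>M {1..k} (\<lambda>_. S))"
  using iterate_measurable[of k "{1..k}"] by simp

text \<open>\<open>grad\<close> is continuous only on \<open>X\<close>; composed with the projection
  it is continuous everywhere, and on iterates the projection acts as the identity.\<close>

lemma grad_xit_measurable [measurable]:
  "(\<lambda>z. grad (xit z k)) \<in> borel_measurable (Pi\<^sub>M {1..k} (\<lambda>_. S))"
proof -
  have "continuous_on UNIV (\<lambda>x. grad (closest_point X x))"
    using X by (intro continuous_on_compose2[OF grad_cont] continuous_on_closest_point
        image_subsetI closest_point_in_set compact_imp_closed)
  then have "(\<lambda>x. grad (closest_point X x)) \<in> borel_measurable borel"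
    by (rule borel_measurable_continuous_onI)
  from measurable_compose[OF xit_measurable this]
  show ?thesis by (simp add: closest_point_self path.x_mem)
qed

lemma err_measurable [measurable]:
  "(\<lambda>(z, v). err k z v) \<in> borel_measurable (Pi\<^sub>M {1..k} (\<lambda>_. S) \<Otimes>\<^sub>M S)"
  unfolding err_def by measurable

section \<open>Martingale bound for the linear noise term\<close>

lemma prob_space_Q: "prob_space Q"
  using prob_space_distr[OF xi_measurable[of 0]] xi_distr[of 1] by simp

lemma err_mgf:
  "(\<integral>\<^sup>+v. ennreal (exp (a * (err k z v \<bullet> u))) \<partial>Q) \<le> ennreal (exp (a\<^sup>2 * (norm u)\<^sup>2 * \<sigma>\<^sup>2))"
proof -
  interpret Q: prob_space Q by (rule prob_space_Q)
  let ?x = "xit z k"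
  have x: "?x \<in> X" by (rule path.x_mem)
  note [simp] = G_int[OF x]
  \<comment> \<open>A scalar variable along the unit direction of \<open>u\<close>, dominated by the
    noise norm; the length of \<open>u\<close> moves into the parameter. \<open>sgn\<close> also
    covers \<open>u = 0\<close>.\<close>
  define Z where "Z v = err k z v \<bullet> sgn u" for v
  have int: "integrable Q Z" unfolding Z_def err_def by simp
  have mean: "Q.expectation Z = 0"
    unfolding Z_def err_def by (simp add: G_mean[OF x] Q.prob_space)
  have "\<bar>Z v\<bar> \<le> norm (G ?x v - grad ?x)" for v
  proof -
    have "\<bar>Z v\<bar> \<le> norm (err k z v) * norm (sgn u)"
      unfolding Z_def by (rule Cauchy_Schwarz_ineq2)
    also have "\<dots> \<le> norm (err k z v) * 1" by (intro mult_left_mono) (simp_all add: norm_sgn)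
    finally show ?thesis by (simp add: err_def norm_minus_commute)
  qed
  then have "(Z v)\<^sup>2 / \<sigma>\<^sup>2 \<le> (norm (G ?x v - grad ?x))\<^sup>2 / \<sigma>\<^sup>2" for v
    by (intro divide_right_mono) (simp_all add: abs_le_square_iff[symmetric])
  then have "(\<integral>\<^sup>+v. ennreal (exp ((Z v)\<^sup>2 / \<sigma>\<^sup>2)) \<partial>Q)
      \<le> (\<integral>\<^sup>+v. ennreal (exp ((norm (G ?x v - grad ?x))\<^sup>2 / \<sigma>\<^sup>2)) \<partial>Q)"
    by (intro nn_integral_mono) simp
  also have "\<dots> \<le> ennreal (exp 1)" by (rule G_subg[OF x])
  finally have "(\<integral>\<^sup>+v. ennreal (exp ((a * norm u) * Z v)) \<partial>Q) \<le> ennreal (exp ((a * norm u)\<^sup>2 * \<sigma>\<^sup>2))"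
    by (rule Q.subgaussian_mgf[OF int mean sigma_pos])
  moreover have "(a * norm u) * Z v = a * (err k z v \<bullet> u)" for v
  proof -
    have "norm u *\<^sub>R sgn u = u" by (cases "u = 0") (simp_all add: sgn_div_norm)
    then show ?thesis unfolding Z_def by (metis inner_scaleR_right mult.assoc)
  qed
  ultimately show ?thesis by (simp add: power_mult_distrib)
qed

definition noise_at :: "nat \<Rightarrow> 'w \<Rightarrow> real^'d" where
  "noise_at k w = err k (past k w) (xi (Suc k) w)"

definition pos_at :: "nat \<Rightarrow> 'w \<Rightarrow> real^'d" where
  "pos_at k w = xit (past k w) k"

lemma noise_at_measurable [measurable]: "noise_at k \<in> borel_measurable M"
proof -
  have "(\<lambda>w. (past k w, xi (Suc k) w)) \<in> measurable M (Pi\<^sub>M {1..k} (\<lambda>_. S) \<Otimes>\<^sub>M S)"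
    by measurable
  from measurable_compose[OF this err_measurable] show ?thesis
    by (simp add: noise_at_def[abs_def])
qed

lemma pos_at_measurable [measurable]: "pos_at k \<in> borel_measurable M"
  unfolding pos_at_def using measurable_compose[OF past_measurable xit_measurable] .

lemma norm_pos_at_diff: "norm (pos_at k w - xs) \<le> diameter X"
  unfolding pos_at_def by (intro norm_diff_le_diameter_X path.x_mem xs)

text \<open>The martingale part of the weighted gap. With the strict bound \<open>k < n\<close> it
  reads samples up to index \<open>n\<close> exactly.\<close>

definition drift :: "nat \<Rightarrow> 'w \<Rightarrow> real" where
  "drift n w = (\<Sum>k<n. (real k + 1) * (noise_at k w \<bullet> (pos_at k w - xs)))"

lemma drift_measurable [measurable]: "drift n \<in> borel_measurable M"
  unfolding drift_def by measurable

lemma drift_eq_function_of_past: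
  "\<exists>f \<in> borel_measurable (Pi\<^sub>M {1..n} (\<lambda>_. S)). \<forall>w. drift n w = f (past n w)"
proof -
  define f where "f z = (\<Sum>k<n. (real k + 1) * (err k z (z (Suc k)) \<bullet> (xit z k - xs)))" for z
  have "(\<lambda>z. (real k + 1) * (err k z (z (Suc k)) \<bullet> (xit z k - xs)))
      \<in> borel_measurable (Pi\<^sub>M {1..n} (\<lambda>_. S))" if "k < n" for k
  proof -
    have sub: "{1..k} \<subseteq> {1..n}" "Suc k \<in> {1..n}" using that by auto
    \<comment> \<open>Measurability of the \<open>k\<close>-th iterate is known on the product over
      \<open>{1..k}\<close>; restriction carries it to the larger product.\<close>
    have cut: "(\<lambda>z. restrict z {1..k}) \<in> measurable (Pi\<^sub>M {1..n} (\<lambda>_. S)) (Pi\<^sub>M {1..k} (\<lambda>_. S))"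
      using sub(1) by (rule measurable_restrict_subset)
    have xit_cut: "xit (restrict z {1..k}) k = xit z k" for z
      unfolding xit_def by (subst spdhg_cong[where z' = z]) auto
    note [measurable] = measurable_component_singleton[OF sub(2), of "\<lambda>_. S"]
      measurable_compose[OF cut xit_measurable, unfolded xit_cut]
      measurable_compose[OF cut grad_xit_measurable, unfolded xit_cut]
    show ?thesis unfolding err_def by measurable
  qed
  then have "f \<in> borel_measurable (Pi\<^sub>M {1..n} (\<lambda>_. S))"
    unfolding f_def by (intro borel_measurable_sum) auto
  moreover have "drift n w = f (past n w)" for w
    unfolding drift_def f_def noise_at_def pos_at_def err_def
    by (intro sum.cong refl) (simp add: xit_past[symmetric], simp add: past_def)
  ultimately show ?thesis by blast
qed

text \<open>Induction on \<open>n\<close>: the last summand is integrated over the fresh sample with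
  the past fixed. Its bound \<open>c\<close>, through the diameter, does not depend on the past and
  factors out.\<close>

lemma drift_mgf:
  "(\<integral>\<^sup>+w. ennreal (exp (a * drift n w)) \<partial>M)
    \<le> ennreal (exp (a\<^sup>2 * ((diameter X)\<^sup>2 * \<sigma>\<^sup>2 * (\<Sum>k<n. (real k + 1)\<^sup>2))))"
proof (induction n)
  case 0
  then show ?case by (simp add: drift_def emeasure_space_1)
next
  case (Suc n)
  obtain f where f [measurable]: "f \<in> borel_measurable (Pi\<^sub>M {1..n} (\<lambda>_. S))"
    and drift_f: "\<And>w. drift n w = f (past n w)"
    using drift_eq_function_of_past by blast
  define c where "c = exp (a\<^sup>2 * (real n + 1)\<^sup>2 * (diameter X)\<^sup>2 * \<sigma>\<^sup>2)"
  define H where "H z v = ennreal (exp (a * f z)) *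
      ennreal (exp ((a * (real n + 1)) * (err n z v \<bullet> (xit z n - xs))))" for z v
  have H_meas: "(\<lambda>(z, v). H z v) \<in> borel_measurable (Pi\<^sub>M {1..n} (\<lambda>_. S) \<Otimes>\<^sub>M S)"
    unfolding H_def by measurable
  have sets_Q: "sets Q = sets S" using xi_distr[of 1] by (metis le_refl sets_distr)
  have inner: "(\<integral>\<^sup>+v. H z v \<partial>Q) \<le> ennreal (exp (a * f z)) * ennreal c"
    if z: "z \<in> space (Pi\<^sub>M {1..n} (\<lambda>_. S))" for z
  proof -
    have "(\<lambda>v. err n z v) \<in> borel_measurable S"
      using measurable_compose[OF measurable_Pair1'[OF z] err_measurable] by simp
    then have [measurable]: "(\<lambda>v. err n z v) \<in> borel_measurable Q"
      by (simp cong: measurable_cong_sets add: sets_Q)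
    have "(\<integral>\<^sup>+v. H z v \<partial>Q) = ennreal (exp (a * f z)) *
        (\<integral>\<^sup>+v. ennreal (exp ((a * (real n + 1)) * (err n z v \<bullet> (xit z n - xs)))) \<partial>Q)"
      unfolding H_def by (intro nn_integral_cmult) measurable
    also have "\<dots> \<le> ennreal (exp (a * f z)) *
        ennreal (exp ((a * (real n + 1))\<^sup>2 * (norm (xit z n - xs))\<^sup>2 * \<sigma>\<^sup>2))"
      by (intro mult_left_mono err_mgf) simp
    also have "(norm (xit z n - xs))\<^sup>2 \<le> (diameter X)\<^sup>2"
      by (intro power_mono norm_diff_le_diameter_X path.x_mem xs) simp
    then have "ennreal (exp ((a * (real n + 1))\<^sup>2 * (norm (xit z n - xs))\<^sup>2 * \<sigma>\<^sup>2)) \<le> ennreal c"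
      unfolding c_def power_mult_distrib
      by (intro ennreal_leI) (simp add: mult_left_mono mult_right_mono)
    finally show ?thesis by (simp add: mult_left_mono)
  qed
  have "(\<integral>\<^sup>+w. ennreal (exp (a * drift (Suc n) w)) \<partial>M) = (\<integral>\<^sup>+w. H (past n w) (xi (Suc n) w) \<partial>M)"
    unfolding H_def drift_f[symmetric]
    by (intro nn_integral_cong)
      (simp add: drift_def noise_at_def pos_at_def distrib_left mult.assoc
        flip: ennreal_mult exp_add)
  also have "\<dots> = (\<integral>\<^sup>+w. (\<integral>\<^sup>+v. H (past n w) v \<partial>Q) \<partial>M)"
    by (rule nn_integral_next_sample[OF H_meas])
  also have "\<dots> \<le> (\<integral>\<^sup>+w. ennreal (exp (a * drift n w)) * ennreal c \<partial>M)"
    unfolding drift_f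
    by (intro nn_integral_mono inner measurable_space[OF past_measurable])
  also have "\<dots> = (\<integral>\<^sup>+w. ennreal (exp (a * drift n w)) \<partial>M) * ennreal c"
    by (intro nn_integral_multc) simp
  also have "\<dots> \<le> ennreal (exp (a\<^sup>2 * ((diameter X)\<^sup>2 * \<sigma>\<^sup>2 * (\<Sum>k<n. (real k + 1)\<^sup>2)))) * ennreal c"
    using Suc.IH by (rule mult_right_mono) simp
  also have "\<dots> = ennreal (exp (a\<^sup>2 * ((diameter X)\<^sup>2 * \<sigma>\<^sup>2 * (\<Sum>k<Suc n. (real k + 1)\<^sup>2))))"
    unfolding c_def by (simp add: distrib_left mult_ac flip: ennreal_mult exp_add)
  finally show ?case .
qed

lemma prob_drift_gt:
  assumes "\<Omega> > 0"
  shows "prob {w \<in> space M. drift (Suc t) w >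
      sqrt (2 * \<Omega>) * diameter X * \<sigma> * (real t + 1) * sqrt (real t + 2)} \<le> exp (- \<Omega>)"
    (is "prob {w \<in> space M. _ > ?T} \<le> _")
\<comment> \<open>With zero diameter \<open>V\<close> would be 0 and \<open>a\<close> meaningless,
  but then the drift itself vanishes.\<close>
proof (cases "diameter X = 0")
  case True
  then have "drift (Suc t) w = 0" for w
    using norm_pos_at_diff[of _ w] unfolding drift_def by (intro sum.neutral) auto
  then show ?thesis using True by simp
next
  case False
  then have D: "diameter X > 0"
    using diameter_ge_0[OF compact_imp_bounded[OF X(2)]] by linarith
  define V where "V = (diameter X)\<^sup>2 * \<sigma>\<^sup>2 * ((real t + 1)\<^sup>2 * (real t + 2) / 2)"
  have V: "V > 0" unfolding V_def using D sigma_pos by (intro mult_pos_pos divide_pos_pos) auto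
  have T2: "?T\<^sup>2 = 4 * \<Omega> * V"
    unfolding V_def using assms by (simp add: power_mult_distrib)
  have T: "?T > 0" using assms D sigma_pos by simp
  \<comment> \<open>The minimiser of a^2 V - a T, with minimum - T^2 / (4 V). \<open>V\<close> is
    chosen so that this equals \<open>- \<Omega>\<close>.\<close>
  define a where "a = ?T / (2 * V)"
  have a: "a > 0" using T V by (simp add: a_def)
  have "(\<Sum>k<Suc t. (real k + 1)\<^sup>2) \<le> (real t + 1)\<^sup>2 * (real t + 2) / 2"
  proof (induction t)
    case (Suc t)
    have "(real (Suc t) + 1)\<^sup>2 * (real (Suc t) + 2) / 2
        = (real t + 1)\<^sup>2 * (real t + 2) / 2 + (real (Suc t) + 1)\<^sup>2 + (real t + 1) * (real t + 2) / 2"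
      by (simp add: power2_eq_square field_simps)
    moreover have "0 \<le> (real t + 1) * (real t + 2) / 2" by simp
    ultimately show ?case using Suc unfolding sum.lessThan_Suc[of _ "Suc t"] by linarith
  qed simp
  then have "(\<integral>\<^sup>+w. ennreal (exp (a * drift (Suc t) w)) \<partial>M) \<le> ennreal (exp (a\<^sup>2 * V))"
    unfolding V_def
    by (intro order_trans[OF drift_mgf] ennreal_leI iffD2[OF exp_le_cancel_iff] mult_left_mono)
      (simp_all del: sum.lessThan_Suc)
  then have "prob {w \<in> space M. a * drift (Suc t) w \<ge> a * ?T} \<le> exp (a\<^sup>2 * V - a * ?T)"
    by (intro chernoff_bound) auto
  also have "a\<^sup>2 * V - a * ?T = - (?T\<^sup>2 / (4 * V))"
    unfolding a_def using V by (simp add: field_simps power2_eq_square)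
  also have "?T\<^sup>2 / (4 * V) = \<Omega>" unfolding T2 using V by simp
  finally have *: "prob {w \<in> space M. a * drift (Suc t) w \<ge> a * ?T} \<le> exp (- \<Omega>)" .
  have "prob {w \<in> space M. drift (Suc t) w > ?T} \<le> prob {w \<in> space M. a * drift (Suc t) w \<ge> a * ?T}"
    using a by (intro finite_measure_mono) auto
  with * show ?thesis by linarith
qed

section \<open>Squared noise\<close>

lemma noise_at_exp_moment:
  "(\<integral>\<^sup>+w. ennreal (exp ((norm (noise_at k w))\<^sup>2 / \<sigma>\<^sup>2)) \<partial>M) \<le> ennreal (exp 1)"
proof -
  have "(\<integral>\<^sup>+w. ennreal (exp ((norm (noise_at k w))\<^sup>2 / \<sigma>\<^sup>2)) \<partial>M)
      = (\<integral>\<^sup>+w. (\<integral>\<^sup>+v. ennreal (exp ((norm (err k (past k w) v))\<^sup>2 / \<sigma>\<^sup>2)) \<partial>Q) \<partial>M)"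
    unfolding noise_at_def by (rule nn_integral_next_sample) measurable
  also have "\<dots> \<le> (\<integral>\<^sup>+w. ennreal (exp 1) \<partial>M)"
    unfolding err_def norm_minus_commute[of "grad _"]
    by (intro nn_integral_mono G_subg path.x_mem)
  finally show ?thesis by (simp add: emeasure_space_1)
qed

text \<open>By Jensen, the exponential of the average normalised square is at most the average of
  the exponentials, so its mean is at most \<open>exp 1\<close>. The \<open>1\<close> in
  \<open>1 + \<Omega>\<close> compensates exactly this moment in Chernoff's bound.\<close>

lemma prob_noise_squares_ge:
  "prob {w \<in> space M. (\<Sum>k\<le>t. (norm (noise_at k w))\<^sup>2) \<ge> (1 + \<Omega>) * \<sigma>\<^sup>2 * (real t + 1)} \<le> exp (- \<Omega>)"
proof -
  define c where "c = 1 / (real t + 1)"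
  have c: "c > 0" by (simp add: c_def)
  define Z where "Z w = (\<Sum>k\<le>t. c * ((norm (noise_at k w))\<^sup>2 / \<sigma>\<^sup>2))" for w
  have [measurable]: "Z \<in> borel_measurable M" unfolding Z_def by measurable
  have "exp (Z w) \<le> (\<Sum>k\<le>t. c * exp ((norm (noise_at k w))\<^sup>2 / \<sigma>\<^sup>2))" for w
    using convex_on_sum[OF _ _ exp_convex, of "{..t}" "\<lambda>_. c"
        "\<lambda>k. (norm (noise_at k w))\<^sup>2 / \<sigma>\<^sup>2"] c
    by (simp add: Z_def c_def add.commute)
  then have "(\<integral>\<^sup>+w. ennreal (exp (Z w)) \<partial>M)
      \<le> (\<integral>\<^sup>+w. (\<Sum>k\<le>t. ennreal c * ennreal (exp ((norm (noise_at k w))\<^sup>2 / \<sigma>\<^sup>2))) \<partial>M)"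
    using c by (intro nn_integral_mono) (simp flip: ennreal_mult add: ennreal_leI)
  also have "\<dots> = (\<Sum>k\<le>t. ennreal c * (\<integral>\<^sup>+w. ennreal (exp ((norm (noise_at k w))\<^sup>2 / \<sigma>\<^sup>2)) \<partial>M))"
    by (simp add: nn_integral_sum nn_integral_cmult)
  also have "\<dots> \<le> (\<Sum>k\<le>t. ennreal c * ennreal (exp 1))"
    by (intro sum_mono mult_left_mono noise_at_exp_moment) simp
  also have "\<dots> = ennreal (\<Sum>k\<le>t. c * exp 1)"
    using c by (simp add: ennreal_mult[symmetric] del: sum_constant)
  also have "(\<Sum>k\<le>t. c * exp 1) = exp (1 :: real)" by (simp add: c_def add.commute)
  finally have "prob {w \<in> space M. Z w \<ge> 1 + \<Omega>} \<le> exp (1 - (1 + \<Omega>))"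
    by (intro chernoff_bound) auto
  moreover have "Z w \<ge> 1 + \<Omega> \<longleftrightarrow>
      (\<Sum>k\<le>t. (norm (noise_at k w))\<^sup>2) \<ge> (1 + \<Omega>) * \<sigma>\<^sup>2 * (real t + 1)" for w
  proof -
    have "Z w = (\<Sum>k\<le>t. (norm (noise_at k w))\<^sup>2) / (\<sigma>\<^sup>2 * (real t + 1))"
      by (simp add: Z_def c_def sum_divide_distrib mult.commute)
    then show ?thesis using sigma_pos by (simp add: pos_le_divide_eq mult.assoc)
  qed
  ultimately show ?thesis by simp
qed

section \<open>Union of the two noise events\<close>

lemma high_probability_gap:
  fixes t :: nat
  assumes \<Omega>: "\<Omega> > 0"
  defines "\<alpha> \<equiv> \<lambda>j. 2 * real j / ((real t + 1) * (real t + 2))"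
  shows "prob {w \<in> space M.
      saddle_fn l F ys (\<Sum>k = 0..t. \<alpha> (Suc k) *\<^sub>R snd (iterate (\<lambda>j. xi j w) (Suc k)))
      - saddle_fn l F (\<Sum>k = 0..t. \<alpha> (Suc k) *\<^sub>R fst (iterate (\<lambda>j. xi j w) (Suc k))) xs
      > (diameter Y)\<^sup>2 / (s * (real t + 2)) + L * (diameter X)\<^sup>2 / (real t + 2)
        + 4 * lam * (diameter Y)\<^sup>2 / (\<mu> * (real t + 2))
        + 2 * sqrt (2 * \<Omega>) * diameter X * \<sigma> / sqrt (real t + 2)
        + 4 * (1 + \<Omega>) * \<sigma>\<^sup>2 / (\<mu> * (real t + 2))} \<le> 2 * exp (- \<Omega>)"
    (is "prob {w \<in> space M. ?gap w > ?C + ?b1 + ?b2} \<le> _")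
proof -
  define T where "T = sqrt (2 * \<Omega>) * diameter X * \<sigma> * (real t + 1) * sqrt (real t + 2)"
  define R where "R = (1 + \<Omega>) * \<sigma>\<^sup>2 * (real t + 1)"
  define N where "N w = (\<Sum>k\<le>t. (norm (noise_at k w))\<^sup>2)" for w
  \<comment> \<open>Path quantities agree with those computed from the past alone, which expresses
    the pathwise bound through \<open>drift\<close> and \<open>N\<close>.\<close>
  have noise: "grad (xit (\<lambda>j. xi j w) k) - G (xit (\<lambda>j. xi j w) k) (xi (Suc k) w) = noise_at k w"
    and pos: "xit (\<lambda>j. xi j w) k = pos_at k w" for w k
    by (simp_all add: noise_at_def pos_at_def err_def xit_past[of k k])
  have gap: "?gap w \<le> ?C + 2 / ((real t + 1) * (real t + 2)) * drift (Suc t) w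
      + 4 / (\<mu> * (real t + 1) * (real t + 2)) * N w" for w
    using path.averaged_gap[where z = "\<lambda>j. xi j w" and t = t]
    unfolding noise unfolding pos drift_def N_def \<alpha>_def xit_def[symmetric] yit_def[symmetric]
      lessThan_Suc_atMost .
  \<comment> \<open>The thresholds \<open>T\<close> and \<open>R\<close>, once multiplied by the
    coefficients in \<open>gap\<close>, are exactly the last two summands of the bound.\<close>
  have b1: "2 / ((real t + 1) * (real t + 2)) * T = ?b1"
  proof -
    have "sqrt (real t + 2) * sqrt (real t + 2) = real t + 2" by simp
    then show ?thesis unfolding T_def by (simp add: divide_simps)
  qed
  have b2: "4 / (\<mu> * (real t + 1) * (real t + 2)) * R = ?b2"
    unfolding R_def by (simp add: divide_simps)
  have "{w \<in> space M. ?gap w > ?C + ?b1 + ?b2}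
      \<subseteq> {w \<in> space M. drift (Suc t) w > T} \<union> {w \<in> space M. N w \<ge> R}"
  proof (intro subsetI, rule ccontr)
    fix w assume w: "w \<in> {w \<in> space M. ?gap w > ?C + ?b1 + ?b2}"
      and "w \<notin> {w \<in> space M. drift (Suc t) w > T} \<union> {w \<in> space M. N w \<ge> R}"
    then have "drift (Suc t) w \<le> T" "N w \<le> R" by auto
    then have "2 / ((real t + 1) * (real t + 2)) * drift (Suc t) w \<le> ?b1"
      and "4 / (\<mu> * (real t + 1) * (real t + 2)) * N w \<le> ?b2"
      unfolding b1[symmetric] b2[symmetric] using mu_pos by (intro mult_left_mono; simp)+
    then show False using gap[of w] w by simp
  qed
  \<comment> \<open>Monotonicity asks for measurability of the covering union, whose two events come
    from measurable functions.\<close>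
  then have "prob {w \<in> space M. ?gap w > ?C + ?b1 + ?b2}
      \<le> prob ({w \<in> space M. drift (Suc t) w > T} \<union> {w \<in> space M. N w \<ge> R})"
    unfolding N_def by (intro finite_measure_mono) measurable
  also have "\<dots> \<le> prob {w \<in> space M. drift (Suc t) w > T} + prob {w \<in> space M. N w \<ge> R}"
    unfolding N_def by (intro measure_Un_le) measurable
  also have "\<dots> \<le> exp (- \<Omega>) + exp (- \<Omega>)"
    unfolding T_def N_def R_def by (intro add_mono prob_drift_gt[OF \<Omega>] prob_noise_squares_ge)
  finally show ?thesis by simp
qed

end

theorem theorem6:
  fixes M :: "'w measure" and S :: "'b measure" and Q :: "'b measure"
    and X :: "(real^'d) set" and Y :: "(real^'l) set" and F :: "real^'d^'l"
    and l :: "real^'d \<Rightarrow> real" and grad :: "real^'d \<Rightarrow> real^'d"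
    and G :: "real^'d \<Rightarrow> 'b \<Rightarrow> real^'d" and xi :: "nat \<Rightarrow> 'w \<Rightarrow> 'b"
    and L \<mu> \<sigma> s \<Omega> :: real and x0 xs :: "real^'d" and y0 ys :: "real^'l" and t :: nat
  assumes M: "prob_space M"
    and X: "convex X" "compact X" "X \<noteq> {}"
    and Y: "convex Y" "compact Y" "Y \<noteq> {}"
    and deriv: "\<And>x. x \<in> X \<Longrightarrow> (l has_derivative (\<lambda>h. grad x \<bullet> h)) (at x within X)"
    and grad_cont: "continuous_on X grad"
    and lconv: "convex_on X l"
    and Lip: "\<And>x1 x2. x1 \<in> X \<Longrightarrow> x2 \<in> X \<Longrightarrow> norm (grad x1 - grad x2) \<le> L * norm (x1 - x2)"
    and mu_pos: "\<mu> > 0"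
    and strong: "\<And>x y. x \<in> X \<Longrightarrow> y \<in> X \<Longrightarrow>
                   l y - l x - (y - x) \<bullet> grad x \<ge> \<mu> / 2 * (norm (y - x))\<^sup>2"
    and sigma_pos: "\<sigma> > 0"
    and G_meas: "(\<lambda>p. G (fst p) (snd p)) \<in> borel_measurable (borel \<Otimes>\<^sub>M S)"
    and G_int: "\<And>x. x \<in> X \<Longrightarrow> integrable Q (G x)"
    and G_mean: "\<And>x. x \<in> X \<Longrightarrow> (\<integral>z. G x z \<partial>Q) = grad x"
    and G_var: "\<And>x. x \<in> X \<Longrightarrow>
                  (\<integral>\<^sup>+z. ennreal ((norm (G x z - grad x))\<^sup>2) \<partial>Q) \<le> ennreal (\<sigma>\<^sup>2)"
    and G_subg: "\<And>x. x \<in> X \<Longrightarrow>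
                  (\<integral>\<^sup>+z. ennreal (exp ((norm (G x z - grad x))\<^sup>2 / \<sigma>\<^sup>2)) \<partial>Q) \<le> ennreal (exp 1)"
    and xi_indep: "prob_space.indep_vars M (\<lambda>_. S) xi {1..}"
    and xi_distr: "\<And>k. k \<ge> 1 \<Longrightarrow> distr M S (xi k) = Q"
    and s_pos: "s > 0"
    and x0: "x0 \<in> X" and y0: "y0 \<in> Y"
    and saddle: "xs \<in> X" "ys \<in> Y"
      "\<And>y. y \<in> Y \<Longrightarrow> saddle_fn l F y xs \<le> saddle_fn l F ys xs"
      "\<And>x. x \<in> X \<Longrightarrow> saddle_fn l F ys xs \<le> saddle_fn l F ys x"
    and Omega_pos: "\<Omega> > 0"
  shows
    "let beta = (\<lambda>j. 2 / (\<mu> * (real j + 1) + 2 * L));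
         it = (\<lambda>k \<omega>. spdhg l F X Y s G beta x0 y0 (\<lambda>j. xi j \<omega>) k);
         alpha = (\<lambda>j. 2 * real j / ((real t + 1) * (real t + 2)));
         xbar = (\<lambda>\<omega>. \<Sum>k = 0..t. alpha (Suc k) *\<^sub>R snd (it (Suc k) \<omega>));
         ybar = (\<lambda>\<omega>. \<Sum>k = 0..t. alpha (Suc k) *\<^sub>R fst (it (Suc k) \<omega>));
         Dx = diameter X; Dy = diameter Y;
         bound = Dy\<^sup>2 / (s * (real t + 2)) + L * Dx\<^sup>2 / (real t + 2)
               + 4 * lambda_max (transpose F ** F) * Dy\<^sup>2 / (\<mu> * (real t + 2))
               + 2 * sqrt (2 * \<Omega>) * Dx * \<sigma> / sqrt (real t + 2)
               + 4 * (1 + \<Omega>) * \<sigma>\<^sup>2 / (\<mu> * (real t + 2))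
     in measure M {\<omega> \<in> space M. saddle_fn l F ys (xbar \<omega>) - saddle_fn l F (ybar \<omega>) xs > bound}
          \<le> 2 * exp (- \<Omega>)"
proof -
  interpret spdhg_sampling X Y F l grad L \<mu> s xs ys M S Q G xi \<sigma> x0 y0
    using assms by (intro spdhg_sampling.intro spdhg_sampling_axioms.intro
        strongly_convex_saddle.intro) auto
  show ?thesis
    unfolding Let_def by (rule high_probability_gap[OF Omega_pos])
qed

end
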